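(* Let $n,\ell\ge2$ and consider a disjoint family of subsets $F^1,\dots,F^\ell$ of $\{1,\dots,n\}$ whose union is the entire set, with $|F^1|\ge\dots\ge|F^\ell|$. Given $|F^i|$-symmetric kernels $\mathfrak{I}_i:\mathbb{X}_{F^i}\times\mathbb{X}_{F^i}\to\mathbb{R}$, $1\le i\le\ell$, the kernel $$\mathfrak{I}(x_{\vec 1},x_{\vec 2})=\prod_{i=1}^\ell\mathfrak{I}_i(x_{\vec 1_{F^i}},x_{\vec 2_{F^i}})$$ on $\mathbb{X}_n$ is $\mathrm{SPDI}_2$ if and only if (in the respective case): (i) $\ell>2$: for every $1\le i\le\ell$ the kernel $(-1)^{a_i}\mathfrak{I}_i$ is SPD for some $a_i\in\{0,1\}$ such that $\sum_{i=1}^\ell a_i\in2\mathbb{N}$ (that is, the sum is even, $0$ allowed). (ii) $\ell=2=n$: for every $1\le i\le2$ the kernel $(-1)^a\mathfrak{I}_i$ is strictly conditionally negative definite, for some $a\in\{0,1\}$ (the same for both $i$). (iii) $\ell=2<n$ and $|F^2|=1$: the kernel $(-1)^{a+1}\mathfrak{I}_1$ is strictly conditionally negative definite and the kernel $(-1)^a\mathfrak{I}_2$ is SPD, for some $a\in\{0,1\}$. (iv) $\ell=2<n$ and $|F^2|\ge2$: for every $1\le i\le2$ the kernel $(-1)^a\mathfrak{I}_i$ is SPD, for some $a\in\{0,1\}$ (the same for both $i$).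
   Context: $X_1,\dots,X_n$ are nonempty sets; $\mathbb{X}_n=\prod_{i=1}^nX_i$, $\mathbb{X}_F=\prod_{i\in F}X_i$, and $x_{\vec a_F}$ is the projection of $x_{\vec a}\in\mathbb{X}_n$ onto $\mathbb{X}_F$. $\mathcal{M}_2(\mathbb{X}_n)$ is the set of discrete (finitely supported) real signed measures $\mu$ on $\mathbb{X}_n$ with $\mu(\prod_iA_i)=0$ whenever $A_i\subset X_i$ and $|\{i:A_i=X_i\}|\ge n-1$. A kernel on $\mathbb{X}_F$ is $|F|$-symmetric if its value at a pair of points is unchanged when, for any set of indices $i\in F$, the $i$-th coordinates of the two points are interchanged. An $n$-symmetric kernel $\mathfrak{I}$ on $\mathbb{X}_n$ is $\mathrm{SPDI}_2$ if $\iint\mathfrak{I}(u,v)\,d\mu(u)d\mu(v)\ge0$ for all $\mu\in\mathcal{M}_2(\mathbb{X}_n)$, with equality only for $\mu=0$. A symmetric kernel $\gamma$ on a set $X$ is SPD (strictly positive definite) if $\iint\gamma\,d\mu\,d\mu>0$ for every nonzero finitely supported signed measure $\mu$, and strictly conditionally negative definite if $\iint\gamma\,d\mu\,d\mu<0$ for every nonzero finitely supported signed measure $\mu$ with $\mu(X)=0$.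
   Formalization: Every X_i is assumed to have at least two points and every F^i to be nonempty; with one-point X_i the claim fails (n=ℓ=3, all I_i=0: M_2={0}, so the product is SPDI_2, but no I_i is ±SPD). *)

theory Defs
  imports Complex_Main "HOL-Library.FuncSet" "HOL-Library.Disjoint_Sets"
begin

text \<open>
  A finitely supported real signed measure on a set \<open>S\<close> is represented by its point masses.
\<close>

definition discrete_measures :: "'p set \<Rightarrow> ('p \<Rightarrow> real) set" where
  "discrete_measures S = {\<mu>. finite {x. \<mu> x \<noteq> 0} \<and> {x. \<mu> x \<noteq> 0} \<subseteq> S}"

definition mass :: "('p \<Rightarrow> real) \<Rightarrow> 'p set \<Rightarrow> real" where
  "mass \<mu> A = (\<Sum>x\<in>A \<inter> {x. \<mu> x \<noteq> 0}. \<mu> x)"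

definition double_integral :: "('p \<Rightarrow> 'p \<Rightarrow> real) \<Rightarrow> ('p \<Rightarrow> real) \<Rightarrow> real" where
  "double_integral K \<mu> = (\<Sum>u\<in>{x. \<mu> x \<noteq> 0}. \<Sum>v\<in>{x. \<mu> x \<noteq> 0}. K u v * \<mu> u * \<mu> v)"

text \<open>
  Kernels on \<open>S\<close> are total functions of which only the values on \<open>S \<times> S\<close> are relevant.
\<close>

definition symmetric_kernel :: "'p set \<Rightarrow> ('p \<Rightarrow> 'p \<Rightarrow> real) \<Rightarrow> bool" where
  "symmetric_kernel S \<gamma> \<longleftrightarrow> (\<forall>u\<in>S. \<forall>v\<in>S. \<gamma> u v = \<gamma> v u)"

definition SPD :: "'p set \<Rightarrow> ('p \<Rightarrow> 'p \<Rightarrow> real) \<Rightarrow> bool" where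
  "SPD S \<gamma> \<longleftrightarrow> symmetric_kernel S \<gamma> \<and>
     (\<forall>\<mu>\<in>discrete_measures S. \<mu> \<noteq> (\<lambda>_. 0) \<longrightarrow> double_integral \<gamma> \<mu> > 0)"

definition strictly_CND :: "'p set \<Rightarrow> ('p \<Rightarrow> 'p \<Rightarrow> real) \<Rightarrow> bool" where
  "strictly_CND S \<gamma> \<longleftrightarrow> symmetric_kernel S \<gamma> \<and>
     (\<forall>\<mu>\<in>discrete_measures S. \<mu> \<noteq> (\<lambda>_. 0) \<and> mass \<mu> S = 0 \<longrightarrow> double_integral \<gamma> \<mu> < 0)"

text \<open>
  The product of the sets \<open>X i\<close>, \<open>i \<in> I\<close>, is \<open>PiE I X\<close>, and the projection of a point \<open>x\<close>
  of it onto \<open>PiE F X\<close>, \<open>F \<subseteq> I\<close>, is \<open>restrict x F\<close>.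
  The pair \<open>(override_on u v J, override_on v u J)\<close> arises from \<open>(u, v)\<close> by interchanging the
  coordinates with index in \<open>J\<close>.
\<close>

definition coordinate_symmetric ::
    "'i set \<Rightarrow> ('i \<Rightarrow> 'a set) \<Rightarrow> (('i \<Rightarrow> 'a) \<Rightarrow> ('i \<Rightarrow> 'a) \<Rightarrow> real) \<Rightarrow> bool" where
  "coordinate_symmetric I X K \<longleftrightarrow>
     (\<forall>u\<in>PiE I X. \<forall>v\<in>PiE I X. \<forall>J\<subseteq>I. K (override_on u v J) (override_on v u J) = K u v)"

definition M2 :: "'i set \<Rightarrow> ('i \<Rightarrow> 'a set) \<Rightarrow> (('i \<Rightarrow> 'a) \<Rightarrow> real) set" where
  "M2 I X = {\<mu> \<in> discrete_measures (PiE I X).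
     \<forall>A. (\<forall>i\<in>I. A i \<subseteq> X i) \<and> card I \<le> card {i\<in>I. A i = X i} + 1 \<longrightarrow> mass \<mu> (PiE I A) = 0}"

definition SPDI2 ::
    "'i set \<Rightarrow> ('i \<Rightarrow> 'a set) \<Rightarrow> (('i \<Rightarrow> 'a) \<Rightarrow> ('i \<Rightarrow> 'a) \<Rightarrow> real) \<Rightarrow> bool" where
  "SPDI2 I X K \<longleftrightarrow> coordinate_symmetric I X K \<and>
     (\<forall>\<mu>\<in>M2 I X. double_integral K \<mu> \<ge> 0 \<and> (double_integral K \<mu> = 0 \<longrightarrow> \<mu> = (\<lambda>_. 0)))"

end

theory Submission imports Defs begin

text \<open>
  A measure lies in \<open>M2\<close> iff its one-dimensional marginals vanish. Hence, for disjoint \<open>F\<close> and \<open>G\<close>,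
  the product \<open>\<mu> \<otimes> \<nu>\<close> is in \<open>M2\<close> as soon as both factors have mass zero, or \<open>\<nu>\<close> alone is in
  \<open>M2\<close> and \<open>\<mu>\<close> is arbitrary; the quadratic form of a product kernel is multiplicative on such
  products. If \<open>\<nu>\<close> can be chosen nonzero in \<open>M2\<close>, which only requires two indices outside \<open>F\<close>,
  the factor on \<open>F\<close> has constant strict sign on all measures; otherwise only on those of mass zero.
  Conversely, the tensor product of two strictly positive definite forms is strictly positive
  definite, by a Schur complement argument, also on measures all of whose sections have mass zero
  when a factor is only conditionally definite; vanishing marginals give this condition exactly for
  a block whose complement is a single index.
\<close>

section \<open>Positivity of entrywise products of matrices\<close>

text \<open>Induction on \<open>C\<close>, eliminating one index \<open>b\<close> at a time by a
  Schur complement. Subtracting the rank one matrix \<open>K x b * K y b / K b b\<close> from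
  \<open>K\<close> clears row and column \<open>b\<close> and leaves a strictly positive definite
  matrix on the other indices, while the subtracted part pairs with \<open>G\<close> to a
  nonnegative multiple of a value of the form of \<open>G\<close>. The index \<open>p\<close> is
  never eliminated, so the induction ends with \<open>K p p * G p p > 0\<close>; hence a single
  positive diagonal entry of \<open>G\<close> suffices.\<close>

lemma schur_trace_pos:
  fixes K G :: "'b \<Rightarrow> 'b \<Rightarrow> real"
  assumes "finite C" "p \<notin> C"
    and "\<And>x y. x \<in> insert p C \<Longrightarrow> y \<in> insert p C \<Longrightarrow> K x y = K y x"
    and "\<And>f. \<exists>x\<in>insert p C. f x \<noteq> 0 \<Longrightarrow>
           (\<Sum>x\<in>insert p C. \<Sum>y\<in>insert p C. K x y * f x * f y) > 0"
    and "\<And>c. (\<Sum>x\<in>insert p C. \<Sum>y\<in>insert p C. G x y * c x * c y) \<ge> 0"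
    and "G p p > 0"
  shows "(\<Sum>x\<in>insert p C. \<Sum>y\<in>insert p C. K x y * G x y) > 0"
  using assms
proof (induction C arbitrary: K rule: finite_induct)
  case empty
  from empty(3)[of "\<lambda>_. 1"] empty(5) show ?case by simp
next
  case (insert b C)
  define D where "D = insert p C"
  have D: "finite D" "b \<notin> D" "insert p (insert b C) = insert b D"
    using insert.hyps insert.prems(1) by (auto simp: D_def)
  note sym = insert.prems(2)[unfolded D(3)] and pd = insert.prems(3)[unfolded D(3)]
    and psd = insert.prems(4)[unfolded D(3)]
  have split: "(\<Sum>x\<in>insert b D. \<Sum>y\<in>insert b D. h x y)
      = h b b + (\<Sum>y\<in>D. h b y) + (\<Sum>x\<in>D. h x b) + (\<Sum>x\<in>D. \<Sum>y\<in>D. h x y)" for h :: "'b \<Rightarrow> 'b \<Rightarrow> real"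
    using D by (simp add: sum.distrib)
  have "(\<Sum>x\<in>insert b D. \<Sum>y\<in>insert b D. K x y * of_bool (x = b) * of_bool (y = b)) = K b b"
    unfolding split using D by (auto intro!: sum.neutral)
  with pd[of "\<lambda>x. of_bool (x = b)"] have Kb: "K b b > 0" by simp
  define K' where "K' = (\<lambda>x y. K x y - K x b * K y b / K b b)"
  have "(\<Sum>x\<in>insert p C. \<Sum>y\<in>insert p C. K' x y * G x y) > 0"
  proof (rule insert.IH)
    show "p \<notin> C" using insert.prems(1) by simp
    show "K' x y = K' y x" if "x \<in> insert p C" "y \<in> insert p C" for x y
      using sym that by (simp add: K'_def D_def)
    show "(\<Sum>x\<in>insert p C. \<Sum>y\<in>insert p C. K' x y * f x * f y) > 0"
      if ex: "\<exists>x\<in>insert p C. f x \<noteq> 0" for f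
    proof -
      \<comment> \<open>Completing the square: for \<open>f\<close> given on \<open>D\<close>, the
        value \<open>- s / K b b\<close> at \<open>b\<close> minimises the form of \<open>K\<close>,
        and the minimum is the form of \<open>K'\<close> at \<open>f\<close>.\<close>
      define s where "s = (\<Sum>x\<in>D. K x b * f x)"
      define g where "g = f(b := - s / K b b)"
      have gD: "g x = f x" if "x \<in> D" for x using that D by (auto simp: g_def)
      have "0 < (\<Sum>x\<in>insert b D. \<Sum>y\<in>insert b D. K x y * g x * g y)"
        by (rule pd) (use ex gD in \<open>auto simp: D_def\<close>)
      also have "\<dots> = K b b * g b * g b + g b * s + g b * s + (\<Sum>x\<in>D. \<Sum>y\<in>D. K x y * f x * f y)"
      proof -
        have "(\<Sum>y\<in>D. K b y * g b * g y) = g b * s"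
          unfolding s_def sum_distrib_left by (rule sum.cong) (auto simp: gD sym)
        moreover have "(\<Sum>x\<in>D. K x b * g x * g b) = g b * s"
          unfolding s_def sum_distrib_left by (rule sum.cong) (auto simp: gD)
        moreover have "(\<Sum>x\<in>D. \<Sum>y\<in>D. K x y * g x * g y) = (\<Sum>x\<in>D. \<Sum>y\<in>D. K x y * f x * f y)"
          by (intro sum.cong) (auto simp: gD)
        ultimately show ?thesis unfolding split by simp
      qed
      also have "\<dots> = (\<Sum>x\<in>D. \<Sum>y\<in>D. K x y * f x * f y) - s * s / K b b"
        using Kb by (simp add: g_def field_simps)
      also have "s * s / K b b = (\<Sum>x\<in>D. \<Sum>y\<in>D. K x b * K y b / K b b * f x * f y)"
        unfolding s_def sum_product sum_divide_distrib by (intro sum.cong) auto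
      also have "(\<Sum>x\<in>D. \<Sum>y\<in>D. K x y * f x * f y) - \<dots> = (\<Sum>x\<in>D. \<Sum>y\<in>D. K' x y * f x * f y)"
        unfolding K'_def by (simp add: sum_subtractf algebra_simps)
      finally show ?thesis by (simp add: D_def)
    qed
    show "(\<Sum>x\<in>insert p C. \<Sum>y\<in>insert p C. G x y * c x * c y) \<ge> 0" for c
    proof -
      \<comment> \<open>Testing \<open>G\<close> on \<open>c\<close> set to zero at \<open>b\<close>
        shows that its form stays nonnegative on \<open>D\<close>.\<close>
      have "(\<Sum>x\<in>D. \<Sum>y\<in>D. G x y * (c(b := 0)) x * (c(b := 0)) y) = (\<Sum>x\<in>D. \<Sum>y\<in>D. G x y * c x * c y)"
        using D by (intro sum.cong) auto
      with psd[of "c(b := 0)"] show ?thesis unfolding split by (simp add: D_def)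
    qed
  qed fact
  \<comment> \<open>Undoing the subtraction: the rank one part contributes the form of
    \<open>G\<close> at column \<open>b\<close> of \<open>K\<close>, divided by
    \<open>K b b\<close>.\<close>
  moreover have "(\<Sum>x\<in>insert b D. \<Sum>y\<in>insert b D. K x y * G x y)
      = (\<Sum>x\<in>insert b D. \<Sum>y\<in>insert b D. K' x y * G x y)
        + (\<Sum>x\<in>insert b D. \<Sum>y\<in>insert b D. G x y * K x b * K y b) / K b b"
    unfolding K'_def sum_divide_distrib sum.distrib[symmetric]
    by (intro sum.cong) (auto simp: field_simps)
  moreover have "(\<Sum>x\<in>insert b D. \<Sum>y\<in>insert b D. K' x y * G x y) = (\<Sum>x\<in>D. \<Sum>y\<in>D. K' x y * G x y)"
    unfolding split using Kb sym by (simp add: K'_def)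
  moreover have "(\<Sum>x\<in>insert b D. \<Sum>y\<in>insert b D. G x y * K x b * K y b) / K b b \<ge> 0"
    using psd[of "\<lambda>x. K x b"] Kb by simp
  ultimately show ?case unfolding D(3) D_def[symmetric] by linarith
qed

text \<open>
  Since the rows and columns of \<open>G\<close> sum to zero, \<open>K\<close> may be replaced by its normalisation at a
  base point \<open>q\<close>, which is strictly positive definite away from \<open>q\<close>.
\<close>

lemma schur_trace_pos_conditional:
  fixes K G :: "'b \<Rightarrow> 'b \<Rightarrow> real"
  assumes fin: "finite B" and p: "p \<in> B"
    and sym: "\<And>x y. x \<in> B \<Longrightarrow> y \<in> B \<Longrightarrow> K x y = K y x"
    and pd: "\<And>f. \<exists>x\<in>B. f x \<noteq> 0 \<Longrightarrow> (\<Sum>x\<in>B. f x) = 0 \<Longrightarrow>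
           (\<Sum>x\<in>B. \<Sum>y\<in>B. K x y * f x * f y) > 0"
    and psd: "\<And>c. (\<Sum>x\<in>B. \<Sum>y\<in>B. G x y * c x * c y) \<ge> 0"
    and Gp: "G p p > 0"
    and row: "\<And>x. x \<in> B \<Longrightarrow> (\<Sum>y\<in>B. G x y) = 0"
    and col: "\<And>y. y \<in> B \<Longrightarrow> (\<Sum>x\<in>B. G x y) = 0"
  shows "(\<Sum>x\<in>B. \<Sum>y\<in>B. K x y * G x y) > 0"
proof -
  \<comment> \<open>A row that sums to zero cannot consist of the positive entry
    \<open>G p p\<close> alone, so a base point \<open>q\<close> other than \<open>p\<close>
    exists.\<close>
  have "B \<noteq> {p}" using row[OF p] Gp by auto
  then obtain q where q: "q \<in> B" "q \<noteq> p" using p by auto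
  define C where "C = B - {p, q}"
  define D where "D = B - {q}"
  have D: "finite D" "q \<notin> D" "B = insert q D" "D = insert p C"
    using fin p q by (auto simp: D_def C_def)
  have split: "(\<Sum>x\<in>B. \<Sum>y\<in>B. h x y)
      = h q q + (\<Sum>y\<in>D. h q y) + (\<Sum>x\<in>D. h x q) + (\<Sum>x\<in>D. \<Sum>y\<in>D. h x y)" for h :: "'b \<Rightarrow> 'b \<Rightarrow> real"
    using D(1,2) unfolding D(3) by (simp add: sum.distrib)
  \<comment> \<open>Each correction term depends on at most one of \<open>x\<close> and
    \<open>y\<close>, so it sums to zero against any \<open>H\<close> whose rows and columns sum to
    zero. As \<open>K'\<close> vanishes when \<open>x = q\<close> or \<open>y = q\<close>, the sum
    over \<open>B\<close> then shrinks to one over \<open>D\<close>.\<close>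
  define K' where "K' = (\<lambda>x y. K x y - K x q - K q y + K q q)"
  have reduce: "(\<Sum>x\<in>B. \<Sum>y\<in>B. K x y * H x y) = (\<Sum>x\<in>D. \<Sum>y\<in>D. K' x y * H x y)"
    if H: "\<And>x. x \<in> B \<Longrightarrow> (\<Sum>y\<in>B. H x y) = 0" "\<And>y. y \<in> B \<Longrightarrow> (\<Sum>x\<in>B. H x y) = 0"
    for H :: "'b \<Rightarrow> 'b \<Rightarrow> real"
  proof -
    have "(\<Sum>x\<in>B. \<Sum>y\<in>B. K x q * H x y) = 0" "(\<Sum>x\<in>B. \<Sum>y\<in>B. K q q * H x y) = 0"
      using H(1) by (simp_all add: sum_distrib_left[symmetric])
    moreover have "(\<Sum>x\<in>B. \<Sum>y\<in>B. K q y * H x y) = 0"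
      by (subst sum.swap) (use H(2) in \<open>simp add: sum_distrib_left[symmetric]\<close>)
    ultimately have "(\<Sum>x\<in>B. \<Sum>y\<in>B. K x y * H x y) = (\<Sum>x\<in>B. \<Sum>y\<in>B. K' x y * H x y)"
      unfolding K'_def by (simp add: algebra_simps sum.distrib sum_subtractf)
    also have "\<dots> = (\<Sum>x\<in>D. \<Sum>y\<in>D. K' x y * H x y)"
      unfolding split by (simp add: K'_def)
    finally show ?thesis .
  qed
  have "(\<Sum>x\<in>insert p C. \<Sum>y\<in>insert p C. K' x y * G x y) > 0"
  proof (rule schur_trace_pos)
    show "finite C" "p \<notin> C" using fin by (auto simp: C_def)
    show "K' x y = K' y x" if "x \<in> insert p C" "y \<in> insert p C" for x y
      using that p q(1) sym[of x y] sym[of x q] sym[of y q] by (auto simp: K'_def C_def)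
    show "(\<Sum>x\<in>insert p C. \<Sum>y\<in>insert p C. K' x y * f x * f y) > 0"
      if ex: "\<exists>x\<in>insert p C. f x \<noteq> 0" for f
    proof -
      \<comment> \<open>The value at \<open>q\<close> makes \<open>g\<close> sum to zero, so the
        conditional hypothesis applies to it. The matrix \<open>g x * g y\<close> then has zero row
        and column sums, and \<open>reduce\<close> turns the form of \<open>K\<close> at
        \<open>g\<close> into the form of \<open>K'\<close> at \<open>f\<close>.\<close>
      define g where "g = f(q := - (\<Sum>x\<in>D. f x))"
      have gD: "g x = f x" if "x \<in> D" for x using that D by (auto simp: g_def)
      have "(\<Sum>x\<in>D. g x) = (\<Sum>x\<in>D. f x)" by (rule sum.cong) (auto simp: gD)
      then have g0: "(\<Sum>x\<in>B. g x) = 0"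
        using D(1,2) unfolding D(3) by (simp add: g_def)
      have "0 < (\<Sum>x\<in>B. \<Sum>y\<in>B. K x y * g x * g y)"
        by (rule pd[OF _ g0]) (use ex gD D(3,4) in auto)
      also have "\<dots> = (\<Sum>x\<in>B. \<Sum>y\<in>B. K x y * (g x * g y))" by (simp add: mult.assoc)
      also have "\<dots> = (\<Sum>x\<in>D. \<Sum>y\<in>D. K' x y * (g x * g y))"
        by (rule reduce) (simp_all add: g0 sum_distrib_left[symmetric] sum_distrib_right[symmetric])
      also have "\<dots> = (\<Sum>x\<in>D. \<Sum>y\<in>D. K' x y * f x * f y)"
        by (intro sum.cong) (auto simp: gD)
      finally show ?thesis by (simp add: D(4))
    qed
    show "(\<Sum>x\<in>insert p C. \<Sum>y\<in>insert p C. G x y * c x * c y) \<ge> 0" for c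
    proof -
      have "(\<Sum>x\<in>D. \<Sum>y\<in>D. G x y * (c(q := 0)) x * (c(q := 0)) y) = (\<Sum>x\<in>D. \<Sum>y\<in>D. G x y * c x * c y)"
        using D by (intro sum.cong) auto
      with psd[of "c(q := 0)"] show ?thesis unfolding split by (simp add: D(4))
    qed
  qed fact
  then show ?thesis using reduce[of G] row col by (simp add: D(4))
qed

section \<open>Finite sums for integrals, and strict definiteness\<close>

lemma double_integral_superset:
  assumes "finite A" "{x. \<mu> x \<noteq> 0} \<subseteq> A"
  shows "double_integral K \<mu> = (\<Sum>u\<in>A. \<Sum>v\<in>A. K u v * \<mu> u * \<mu> v)"
proof -
  have "(\<Sum>v\<in>{x. \<mu> x \<noteq> 0}. K u v * \<mu> u * \<mu> v) = (\<Sum>v\<in>A. K u v * \<mu> u * \<mu> v)" for u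
    by (rule sum.mono_neutral_left) (use assms in auto)
  then show ?thesis unfolding double_integral_def
    by simp (rule sum.mono_neutral_left, use assms in auto)
qed

lemma mass_superset:
  assumes "finite A" "{x. \<mu> x \<noteq> 0} \<subseteq> A"
  shows "mass \<mu> S = (\<Sum>x\<in>A. if x \<in> S then \<mu> x else 0)"
proof -
  have "mass \<mu> S = (\<Sum>x\<in>A \<inter> S. \<mu> x)"
    unfolding mass_def by (rule sum.mono_neutral_left) (use assms in auto)
  also have "\<dots> = (\<Sum>x\<in>A. if x \<in> S then \<mu> x else 0)"
    by (rule sum.inter_restrict) fact
  finally show ?thesis .
qed

lemma double_integral_scale: "double_integral (\<lambda>u v. c * K u v) \<mu> = c * double_integral K \<mu>"
  by (simp add: double_integral_def sum_distrib_left mult.assoc)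

text \<open>The flag \<open>cond\<close> restricts the test measures to mass zero. It covers SPD
  kernels and negated strictly conditionally negative definite kernels at once, so that one tensor
  product argument serves every combination of the two.\<close>

definition strictly_PD :: "bool \<Rightarrow> 'p set \<Rightarrow> ('p \<Rightarrow> 'p \<Rightarrow> real) \<Rightarrow> bool" where
  "strictly_PD cond S \<gamma> \<longleftrightarrow> symmetric_kernel S \<gamma> \<and>
     (\<forall>\<mu>\<in>discrete_measures S. \<mu> \<noteq> (\<lambda>_. 0) \<and> (cond \<longrightarrow> mass \<mu> S = 0) \<longrightarrow> double_integral \<gamma> \<mu> > 0)"

lemma SPD_iff_strictly_PD: "SPD S \<gamma> \<longleftrightarrow> strictly_PD False S \<gamma>"
  by (simp add: SPD_def strictly_PD_def)

lemma strictly_CND_iff_strictly_PD: "strictly_CND S \<gamma> \<longleftrightarrow> strictly_PD True S (\<lambda>u v. - \<gamma> u v)"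
  using double_integral_scale[of "-1" \<gamma>]
  by (simp add: strictly_CND_def strictly_PD_def symmetric_kernel_def)

lemma strictly_PD_finite_sum:
  assumes "strictly_PD cond S K" "finite A" "A \<subseteq> S" "\<exists>x\<in>A. f x \<noteq> 0" "cond \<Longrightarrow> (\<Sum>x\<in>A. f x) = 0"
  shows "(\<Sum>x\<in>A. \<Sum>y\<in>A. K x y * f x * f y) > 0"
proof -
  define \<mu> where "\<mu> = (\<lambda>x. if x \<in> A then f x else 0)"
  have supp: "{x. \<mu> x \<noteq> 0} \<subseteq> A" by (auto simp: \<mu>_def)
  have "\<mu> \<in> discrete_measures S" "\<mu> \<noteq> (\<lambda>_. 0)"
    using supp assms(2-4) finite_subset[OF supp] by (auto simp: discrete_measures_def \<mu>_def fun_eq_iff)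
  moreover have "mass \<mu> S = (\<Sum>x\<in>A. f x)"
    unfolding mass_superset[OF assms(2) supp] using assms(3)
    by (intro sum.cong) (auto simp: \<mu>_def)
  ultimately have "double_integral K \<mu> > 0"
    using assms(1,5) by (simp add: strictly_PD_def)
  also have "double_integral K \<mu> = (\<Sum>x\<in>A. \<Sum>y\<in>A. K x y * f x * f y)"
    unfolding double_integral_superset[OF assms(2) supp] by (intro sum.cong) (auto simp: \<mu>_def)
  finally show ?thesis .
qed

text \<open>
  Grouping the double sum by the second factor turns it into the sum of the entrywise product of
  \<open>K2\<close> with the Gram matrix of the sections \<open>m _ v\<close> with respect to \<open>K1\<close>.
\<close>

lemma tensor_sum_pos:
  fixes K1 :: "'b \<Rightarrow> 'b \<Rightarrow> real" and K2 :: "'c \<Rightarrow> 'c \<Rightarrow> real" and m :: "'b \<Rightarrow> 'c \<Rightarrow> real"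
  assumes K1: "strictly_PD cond1 S K1" and K2: "strictly_PD cond2 T K2"
    and A: "finite A" "A \<subseteq> S" and B: "finite B" "B \<subseteq> T"
    and ex: "\<exists>u\<in>A. \<exists>v\<in>B. m u v \<noteq> 0"
    and sec1: "\<And>v. cond1 \<Longrightarrow> v \<in> B \<Longrightarrow> (\<Sum>u\<in>A. m u v) = 0"
    and sec2: "\<And>u. cond2 \<Longrightarrow> u \<in> A \<Longrightarrow> (\<Sum>v\<in>B. m u v) = 0"
  shows "(\<Sum>v\<in>B. \<Sum>v'\<in>B. \<Sum>u\<in>A. \<Sum>u'\<in>A. K1 u u' * K2 v v' * m u v * m u' v') > 0"
proof -
  define G where "G = (\<lambda>v v'. \<Sum>u\<in>A. \<Sum>u'\<in>A. K1 u u' * m u v * m u' v')"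
  \<comment> \<open>A section that does not vanish yields the positive diagonal entry of
    \<open>G\<close> that the Schur argument asks for.\<close>
  obtain p where p: "p \<in> B" "\<exists>u\<in>A. m u p \<noteq> 0" using ex by auto
  have sym2: "K2 v v' = K2 v' v" if "v \<in> B" "v' \<in> B" for v v'
    using K2 that B by (auto simp: strictly_PD_def symmetric_kernel_def)
  have Gp: "G p p > 0"
    unfolding G_def by (rule strictly_PD_finite_sum[OF K1 A p(2)]) (use sec1 p in auto)
  have psd: "(\<Sum>v\<in>B. \<Sum>v'\<in>B. G v v' * c v * c v') \<ge> 0" for c
  proof -
    \<comment> \<open>The form of \<open>G\<close> at \<open>c\<close> is the form of
      \<open>K1\<close> at the combination of the sections with coefficients \<open>c\<close>. This
      combination inherits mass zero from the sections.\<close>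
    define f where "f = (\<lambda>u. \<Sum>v\<in>B. c v * m u v)"
    have f0: "(\<Sum>u\<in>A. f u) = 0" if cond1
      unfolding f_def by (subst sum.swap) (use sec1[OF that] in \<open>simp add: sum_distrib_left[symmetric]\<close>)
    have "(\<Sum>u\<in>A. \<Sum>u'\<in>A. K1 u u' * f u * f u') \<ge> 0"
    proof (cases "\<exists>u\<in>A. f u \<noteq> 0")
      case True
      then show ?thesis using strictly_PD_finite_sum[OF K1 A, of f] f0 by (simp add: less_imp_le)
    qed simp
    also have "(\<Sum>u\<in>A. \<Sum>u'\<in>A. K1 u u' * f u * f u')
        = (\<Sum>u\<in>A. \<Sum>u'\<in>A. \<Sum>v\<in>B. \<Sum>v'\<in>B. K1 u u' * m u v * m u' v' * c v * c v')"
    proof (intro sum.cong refl)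
      fix u u'
      have "K1 u u' * f u * f u' = K1 u u' * (f u * f u')" by simp
      also have "\<dots> = (\<Sum>v\<in>B. \<Sum>v'\<in>B. K1 u u' * m u v * m u' v' * c v * c v')"
        unfolding f_def sum_product by (simp add: sum_distrib_left mult_ac)
      finally show "K1 u u' * f u * f u' = (\<Sum>v\<in>B. \<Sum>v'\<in>B. K1 u u' * m u v * m u' v' * c v * c v')" .
    qed
    also have "\<dots> = (\<Sum>v\<in>B. \<Sum>v'\<in>B. \<Sum>u\<in>A. \<Sum>u'\<in>A. K1 u u' * m u v * m u' v' * c v * c v')"
      by (simp add: sum.swap[of _ B A])
    also have "\<dots> = (\<Sum>v\<in>B. \<Sum>v'\<in>B. G v v' * c v * c v')"
      by (simp add: G_def sum_distrib_right)
    finally show ?thesis .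
  qed
  have "(\<Sum>v\<in>B. \<Sum>v'\<in>B. K2 v v' * G v v') > 0"
  proof (cases cond2)
    case True
    show ?thesis
    proof (rule schur_trace_pos_conditional[where p = p])
      \<comment> \<open>Summing over \<open>v'\<close> first leaves the factor
        \<open>\<Sum>v'\<in>B. m u' v'\<close>, which is zero by \<open>sec2\<close>.\<close>
      show "(\<Sum>v'\<in>B. G v v') = 0" for v
      proof -
        have "(\<Sum>v'\<in>B. G v v') = (\<Sum>u\<in>A. \<Sum>u'\<in>A. \<Sum>v'\<in>B. K1 u u' * m u v * m u' v')"
          by (simp add: G_def sum.swap[of _ B A])
        then show ?thesis using sec2[OF True] by (simp add: sum_distrib_left[symmetric])
      qed
      show "(\<Sum>v\<in>B. G v v') = 0" for v'
      proof -
        have "(\<Sum>v\<in>B. G v v') = (\<Sum>u\<in>A. \<Sum>u'\<in>A. \<Sum>v\<in>B. K1 u u' * m u' v' * m u v)"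
          by (simp add: G_def sum.swap[of _ B A] mult_ac)
        then show ?thesis using sec2[OF True] by (simp add: sum_distrib_left[symmetric])
      qed
    qed (use B p sym2 Gp psd strictly_PD_finite_sum[OF K2 B] in auto)
  next
    case False
    \<comment> \<open>\<open>schur_trace_pos\<close> speaks of sets \<open>insert p C\<close>;
      \<open>B\<close> is brought into this shape and folded back in the resulting premises.\<close>
    have ins: "B = insert p (B - {p})" using p by auto
    show ?thesis
      by (subst (1 2) ins, rule schur_trace_pos, unfold ins[symmetric])
        (use B p sym2 Gp psd strictly_PD_finite_sum[OF K2 B] False in auto)
  qed
  also have "(\<Sum>v\<in>B. \<Sum>v'\<in>B. K2 v v' * G v v')
      = (\<Sum>v\<in>B. \<Sum>v'\<in>B. \<Sum>u\<in>A. \<Sum>u'\<in>A. K1 u u' * K2 v v' * m u v * m u' v')"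
    by (simp add: G_def sum_distrib_left mult_ac)
  finally show ?thesis .
qed

section \<open>Splitting points along two disjoint blocks of indices\<close>

lemma override_on_restrict:
  "x \<in> extensional (F \<union> G) \<Longrightarrow> override_on (restrict x F) (restrict x G) G = x"
  by (auto simp: fun_eq_iff override_on_def extensional_def)

lemma restrict_override_on:
  assumes "F \<inter> G = {}" "u \<in> extensional F" "v \<in> extensional G"
  shows "restrict (override_on u v G) F = u" "restrict (override_on u v G) G = v"
  using assms by (auto simp: fun_eq_iff override_on_def extensional_def)

lemma override_on_extensional:
  "u \<in> extensional F \<Longrightarrow> v \<in> extensional G \<Longrightarrow> override_on u v G \<in> extensional (F \<union> G)"
  by (auto simp: override_on_def extensional_def)

text \<open>A point over \<open>F \<union> G\<close> is a pair of points over the blocks, and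
  \<open>override_on u v G\<close> glues the pair together again. Sums over points thereby become
  double sums.\<close>

lemma bij_betw_restrict_pair:
  assumes "F \<inter> G = {}" "A \<subseteq> extensional F" "B \<subseteq> extensional G"
  shows "bij_betw (\<lambda>x. (restrict x F, restrict x G))
           {x \<in> extensional (F \<union> G). restrict x F \<in> A \<and> restrict x G \<in> B} (A \<times> B)"
proof (rule bij_betwI[where g = "\<lambda>(u, v). override_on u v G"])
  show "(\<lambda>(u, v). override_on u v G)
      \<in> A \<times> B \<rightarrow> {x \<in> extensional (F \<union> G). restrict x F \<in> A \<and> restrict x G \<in> B}"
  proof (clarsimp)
    fix u v assume uv: "u \<in> A" "v \<in> B"
    then have ext: "u \<in> extensional F" "v \<in> extensional G" using assms by auto
    then show "override_on u v G \<in> extensional (F \<union> G)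
        \<and> restrict (override_on u v G) F \<in> A \<and> restrict (override_on u v G) G \<in> B"
      using uv by (simp add: restrict_override_on[OF assms(1)] override_on_extensional)
  qed
  show "(restrict (case p of (u, v) \<Rightarrow> override_on u v G) F,
      restrict (case p of (u, v) \<Rightarrow> override_on u v G) G) = p"
    if "p \<in> A \<times> B" for p
  proof (cases p)
    case (Pair u v)
    then have "u \<in> extensional F" "v \<in> extensional G" using that assms by auto
    then show ?thesis by (simp add: Pair restrict_override_on[OF assms(1)])
  qed
qed (simp_all add: override_on_restrict)

lemma sum_restrict_pair:
  assumes "F \<inter> G = {}" "A \<subseteq> extensional F" "B \<subseteq> extensional G"
  shows "(\<Sum>x\<in>{x \<in> extensional (F \<union> G). restrict x F \<in> A \<and> restrict x G \<in> B}.
           h (restrict x F) (restrict x G)) = (\<Sum>u\<in>A. \<Sum>v\<in>B. h u v)"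
  using sum.reindex_bij_betw[OF bij_betw_restrict_pair[OF assms], of "\<lambda>(u, v). h u v"]
  by (simp add: sum.cartesian_product)

lemma finite_restrict_pair:
  assumes "F \<inter> G = {}" "A \<subseteq> extensional F" "B \<subseteq> extensional G" "finite A" "finite B"
  shows "finite {x \<in> extensional (F \<union> G). restrict x F \<in> A \<and> restrict x G \<in> B}"
  using bij_betw_finite[OF bij_betw_restrict_pair[OF assms(1-3)]] assms(4,5) by simp

lemma mem_PiE_Un_iff:
  "x \<in> PiE (F \<union> G) A \<longleftrightarrow>
     x \<in> extensional (F \<union> G) \<and> restrict x F \<in> PiE F A \<and> restrict x G \<in> PiE G A"
  by (auto simp: PiE_iff)

lemma PiE_subset_extensional: "PiE F X \<subseteq> extensional F"
  by (auto simp: PiE_iff)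

text \<open>\<open>tensor_sum_pos\<close> for measures: the masses of the fibres of the two
  projections are the column and row sums of the matrix of point masses.\<close>

lemma double_integral_tensor_pos:
  fixes K1 K2 :: "('i \<Rightarrow> 'a) \<Rightarrow> ('i \<Rightarrow> 'a) \<Rightarrow> real"
  assumes K1: "strictly_PD cond1 (PiE F X) K1" and K2: "strictly_PD cond2 (PiE G X) K2"
    and disj: "F \<inter> G = {}"
    and \<mu>: "\<mu> \<in> discrete_measures (PiE (F \<union> G) X)" "\<mu> \<noteq> (\<lambda>_. 0)"
    and sec1: "\<And>v. cond1 \<Longrightarrow> v \<in> PiE G X \<Longrightarrow> mass \<mu> {x \<in> PiE (F \<union> G) X. restrict x G = v} = 0"
    and sec2: "\<And>u. cond2 \<Longrightarrow> u \<in> PiE F X \<Longrightarrow> mass \<mu> {x \<in> PiE (F \<union> G) X. restrict x F = u} = 0"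
  shows "double_integral
    (\<lambda>x y. K1 (restrict x F) (restrict y F) * K2 (restrict x G) (restrict y G)) \<mu> > 0"
proof -
  let ?S = "{x. \<mu> x \<noteq> 0}"
  define A where "A = (\<lambda>x. restrict x F) ` ?S"
  define B where "B = (\<lambda>x. restrict x G) ` ?S"
  \<comment> \<open>The rectangle spanned by the two projections of the support. It may contain
    points of mass zero, but unlike the support it corresponds exactly to
    \<open>A \<times> B\<close>.\<close>
  define C where "C = {x \<in> extensional (F \<union> G). restrict x F \<in> A \<and> restrict x G \<in> B}"
  define m where "m = (\<lambda>u v. \<mu> (override_on u v G))"
  have S: "finite ?S" "?S \<subseteq> PiE (F \<union> G) X" using \<mu>(1) by (auto simp: discrete_measures_def)
  have A: "finite A" "A \<subseteq> PiE F X" using S by (auto simp: A_def PiE_iff)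
  have B: "finite B" "B \<subseteq> PiE G X" using S by (auto simp: B_def PiE_iff)
  have ext: "A \<subseteq> extensional F" "B \<subseteq> extensional G"
    by (rule order_trans[OF A(2) PiE_subset_extensional], rule order_trans[OF B(2) PiE_subset_extensional])
  have C: "finite C" "?S \<subseteq> C"
  proof -
    show "finite C" unfolding C_def by (rule finite_restrict_pair[OF disj ext A(1) B(1)])
    have "?S \<subseteq> extensional (F \<union> G)" using S(2) PiE_subset_extensional by (rule order_trans)
    then show "?S \<subseteq> C" unfolding C_def A_def B_def by blast
  qed
  have CX: "C \<subseteq> PiE (F \<union> G) X"
    unfolding C_def mem_PiE_Un_iff subset_iff using A(2) B(2) by blast
  have m: "m (restrict x F) (restrict x G) = \<mu> x" if "x \<in> C" for x
    unfolding m_def by (subst override_on_restrict) (use that in \<open>auto simp: C_def\<close>)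
  have sumC: "(\<Sum>x\<in>C. h (restrict x F) (restrict x G)) = (\<Sum>u\<in>A. \<Sum>v\<in>B. h u v)"
    for h :: "_ \<Rightarrow> _ \<Rightarrow> real"
    unfolding C_def by (rule sum_restrict_pair[OF disj ext])
  obtain x0 where x0: "\<mu> x0 \<noteq> 0" using \<mu>(2) by auto
  have "0 < (\<Sum>v\<in>B. \<Sum>v'\<in>B. \<Sum>u\<in>A. \<Sum>u'\<in>A. K1 u u' * K2 v v' * m u v * m u' v')"
  proof (rule tensor_sum_pos[OF K1 K2 A B])
    show "\<exists>u\<in>A. \<exists>v\<in>B. m u v \<noteq> 0"
      using x0 C(2) m[of x0] by (auto simp: A_def B_def intro!: exI[of _ x0])
    show "(\<Sum>u\<in>A. m u v) = 0" if c: cond1 and v: "v \<in> B" for v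
    proof -
      have "0 = (\<Sum>x\<in>C. if x \<in> {x \<in> PiE (F \<union> G) X. restrict x G = v} then \<mu> x else 0)"
        using sec1[OF c, of v] v B mass_superset[OF C] by auto
      also have "\<dots> = (\<Sum>x\<in>C. if restrict x G = v then m (restrict x F) (restrict x G) else 0)"
        using CX m by (intro sum.cong) auto
      also have "\<dots> = (\<Sum>u\<in>A. \<Sum>v'\<in>B. if v' = v then m u v' else 0)"
        by (rule sumC)
      also have "\<dots> = (\<Sum>u\<in>A. m u v)" using v B by simp
      finally show ?thesis by simp
    qed
    show "(\<Sum>v\<in>B. m u v) = 0" if c: cond2 and u: "u \<in> A" for u
    proof -
      have "0 = (\<Sum>x\<in>C. if x \<in> {x \<in> PiE (F \<union> G) X. restrict x F = u} then \<mu> x else 0)"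
        using sec2[OF c, of u] u A mass_superset[OF C] by auto
      also have "\<dots> = (\<Sum>x\<in>C. if restrict x F = u then m (restrict x F) (restrict x G) else 0)"
        using CX m by (intro sum.cong) auto
      also have "\<dots> = (\<Sum>u'\<in>A. \<Sum>v\<in>B. if u' = u then m u' v else 0)"
        by (rule sumC)
      also have "\<dots> = (\<Sum>v\<in>B. m u v)" by (subst sum.swap) (use u A in simp)
      finally show ?thesis by simp
    qed
  qed
  \<comment> \<open>The four sums are reordered to \<open>u\<close>, \<open>v\<close>,
    \<open>u'\<close>, \<open>v'\<close>, so that \<open>sumC\<close> can merge each pair into one
    sum over \<open>C\<close>.\<close>
  also have "\<dots> = (\<Sum>v\<in>B. \<Sum>u\<in>A. \<Sum>v'\<in>B. \<Sum>u'\<in>A. K1 u u' * K2 v v' * m u v * m u' v')"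
    by (intro sum.cong refl sum.swap)
  also have "\<dots> = (\<Sum>u\<in>A. \<Sum>v\<in>B. \<Sum>v'\<in>B. \<Sum>u'\<in>A. K1 u u' * K2 v v' * m u v * m u' v')"
    by (rule sum.swap)
  also have "\<dots> = (\<Sum>u\<in>A. \<Sum>v\<in>B. \<Sum>u'\<in>A. \<Sum>v'\<in>B. K1 u u' * K2 v v' * m u v * m u' v')"
    by (intro sum.cong refl sum.swap)
  also have "\<dots> = (\<Sum>x\<in>C. \<Sum>u'\<in>A. \<Sum>v'\<in>B. K1 (restrict x F) u' * K2 (restrict x G) v'
      * m (restrict x F) (restrict x G) * m u' v')"
    by (rule sumC[symmetric])
  also have "\<dots> = (\<Sum>x\<in>C. \<Sum>y\<in>C. K1 (restrict x F) (restrict y F) * K2 (restrict x G) (restrict y G)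
      * m (restrict x F) (restrict x G) * m (restrict y F) (restrict y G))"
    by (intro sum.cong refl sumC[symmetric])
  also have "\<dots> = (\<Sum>x\<in>C. \<Sum>y\<in>C. K1 (restrict x F) (restrict y F) * K2 (restrict x G) (restrict y G)
      * \<mu> x * \<mu> y)"
    by (intro sum.cong refl) (simp add: m)
  also have "\<dots> = double_integral
      (\<lambda>x y. K1 (restrict x F) (restrict y F) * K2 (restrict x G) (restrict y G)) \<mu>"
    by (rule double_integral_superset[OF C, symmetric])
  finally show ?thesis .
qed

section \<open>Product measures\<close>

text \<open>\<open>restrict\<close> forgets the values outside \<open>F \<union> G\<close>. The
  extensionality test keeps functions with other values there from carrying mass.\<close>

definition prod_measure ::
    "'i set \<Rightarrow> 'i set \<Rightarrow> (('i \<Rightarrow> 'a) \<Rightarrow> real) \<Rightarrow> (('i \<Rightarrow> 'a) \<Rightarrow> real) \<Rightarrow> ('i \<Rightarrow> 'a) \<Rightarrow> real" where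
  "prod_measure F G \<mu> \<nu> x =
     (if x \<in> extensional (F \<union> G) then \<mu> (restrict x F) * \<nu> (restrict x G) else 0)"

lemma supp_prod_measure:
  "{x. prod_measure F G \<mu> \<nu> x \<noteq> 0} =
     {x \<in> extensional (F \<union> G). restrict x F \<in> {u. \<mu> u \<noteq> 0} \<and> restrict x G \<in> {v. \<nu> v \<noteq> 0}}"
  by (auto simp: prod_measure_def)

lemma supp_extensional:
  "\<mu> \<in> discrete_measures (PiE F X) \<Longrightarrow> {u. \<mu> u \<noteq> 0} \<subseteq> extensional F"
  using PiE_subset_extensional by (auto simp: discrete_measures_def PiE_iff)

lemma finite_supp: "\<mu> \<in> discrete_measures S \<Longrightarrow> finite {u. \<mu> u \<noteq> 0}"
  by (simp add: discrete_measures_def)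

lemma finite_supp_prod_measure:
  assumes disj: "F \<inter> G = {}"
    and \<mu>: "\<mu> \<in> discrete_measures (PiE F X)" and \<nu>: "\<nu> \<in> discrete_measures (PiE G X)"
  shows "finite {x. prod_measure F G \<mu> \<nu> x \<noteq> 0}"
  unfolding supp_prod_measure by (rule finite_restrict_pair[OF disj
         supp_extensional[OF \<mu>] supp_extensional[OF \<nu>] finite_supp[OF \<mu>] finite_supp[OF \<nu>]])

lemma prod_measure_discrete:
  assumes disj: "F \<inter> G = {}"
    and \<mu>: "\<mu> \<in> discrete_measures (PiE F X)" and \<nu>: "\<nu> \<in> discrete_measures (PiE G X)"
  shows "prod_measure F G \<mu> \<nu> \<in> discrete_measures (PiE (F \<union> G) X)"
proof -
  have "\<mu> u \<noteq> 0 \<Longrightarrow> u \<in> PiE F X" "\<nu> u \<noteq> 0 \<Longrightarrow> u \<in> PiE G X" for u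
    using \<mu> \<nu> unfolding discrete_measures_def by blast+
  then have "{x. prod_measure F G \<mu> \<nu> x \<noteq> 0} \<subseteq> PiE (F \<union> G) X"
    unfolding supp_prod_measure subset_iff mem_PiE_Un_iff by blast
  with finite_supp_prod_measure[OF disj \<mu> \<nu>] show ?thesis by (simp add: discrete_measures_def)
qed

lemma sum_supp_prod_measure:
  assumes disj: "F \<inter> G = {}"
    and \<mu>: "\<mu> \<in> discrete_measures (PiE F X)" and \<nu>: "\<nu> \<in> discrete_measures (PiE G X)"
  shows "(\<Sum>x\<in>{x. prod_measure F G \<mu> \<nu> x \<noteq> 0}. h (restrict x F) (restrict x G))
     = (\<Sum>u\<in>{u. \<mu> u \<noteq> 0}. \<Sum>v\<in>{v. \<nu> v \<noteq> 0}. h u v)"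
  unfolding supp_prod_measure by (rule sum_restrict_pair[OF disj supp_extensional[OF \<mu>] supp_extensional[OF \<nu>]])

lemma prod_measure_nonzero:
  assumes disj: "F \<inter> G = {}"
    and \<mu>: "\<mu> \<in> discrete_measures (PiE F X)" and \<nu>: "\<nu> \<in> discrete_measures (PiE G X)"
    and nz: "\<mu> \<noteq> (\<lambda>_. 0)" "\<nu> \<noteq> (\<lambda>_. 0)"
  shows "prod_measure F G \<mu> \<nu> \<noteq> (\<lambda>_. 0)"
proof
  assume 0: "prod_measure F G \<mu> \<nu> = (\<lambda>_. 0)"
  have "{u. \<mu> u \<noteq> 0} \<times> {v. \<nu> v \<noteq> 0}
      = (\<lambda>x. (restrict x F, restrict x G)) ` {x. prod_measure F G \<mu> \<nu> x \<noteq> 0}"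
    unfolding supp_prod_measure
    by (rule bij_betw_imp_surj_on[OF bij_betw_restrict_pair[OF disj supp_extensional[OF \<mu>] supp_extensional[OF \<nu>]],
          symmetric])
  also have "\<dots> = {}" using 0 by simp
  finally show False using nz by auto
qed

lemma mass_prod_measure:
  assumes disj: "F \<inter> G = {}"
    and \<mu>: "\<mu> \<in> discrete_measures (PiE F X)" and \<nu>: "\<nu> \<in> discrete_measures (PiE G X)"
  shows "mass (prod_measure F G \<mu> \<nu>) (PiE (F \<union> G) A) = mass \<mu> (PiE F A) * mass \<nu> (PiE G A)"
proof -
  let ?S = "{x. prod_measure F G \<mu> \<nu> x \<noteq> 0}"
  have "mass (prod_measure F G \<mu> \<nu>) (PiE (F \<union> G) A)
      = (\<Sum>x\<in>?S. if x \<in> PiE (F \<union> G) A then prod_measure F G \<mu> \<nu> x else 0)"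
    by (rule mass_superset[OF finite_supp_prod_measure[OF disj \<mu> \<nu>] order_refl])
  also have "\<dots> = (\<Sum>x\<in>?S. (if restrict x F \<in> PiE F A then \<mu> (restrict x F) else 0)
      * (if restrict x G \<in> PiE G A then \<nu> (restrict x G) else 0))"
    by (intro sum.cong refl, subst mem_PiE_Un_iff) (auto simp: prod_measure_def split: if_splits)
  also have "\<dots> = mass \<mu> (PiE F A) * mass \<nu> (PiE G A)"
    unfolding mass_superset[OF finite_supp[OF \<mu>] order_refl]
      mass_superset[OF finite_supp[OF \<nu>] order_refl] sum_product
    by (rule sum_supp_prod_measure[OF disj \<mu> \<nu>, where h = "\<lambda>u v. (if u \<in> PiE F A then \<mu> u else 0)
          * (if v \<in> PiE G A then \<nu> v else 0)"])
  finally show ?thesis .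
qed

lemma double_integral_prod_measure:
  assumes disj: "F \<inter> G = {}"
    and \<mu>: "\<mu> \<in> discrete_measures (PiE F X)" and \<nu>: "\<nu> \<in> discrete_measures (PiE G X)"
  shows "double_integral (\<lambda>x y. K1 (restrict x F) (restrict y F) * K2 (restrict x G) (restrict y G))
     (prod_measure F G \<mu> \<nu>) = double_integral K1 \<mu> * double_integral K2 \<nu>"
proof -
  let ?S = "{x. prod_measure F G \<mu> \<nu> x \<noteq> 0}" and ?A = "{u. \<mu> u \<noteq> 0}" and ?B = "{v. \<nu> v \<noteq> 0}"
  have "double_integral (\<lambda>x y. K1 (restrict x F) (restrict y F) * K2 (restrict x G) (restrict y G))
      (prod_measure F G \<mu> \<nu>)
    = (\<Sum>x\<in>?S. \<Sum>y\<in>?S. K1 (restrict x F) (restrict y F) * K2 (restrict x G) (restrict y G)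
        * (\<mu> (restrict x F) * \<nu> (restrict x G)) * (\<mu> (restrict y F) * \<nu> (restrict y G)))"
    unfolding double_integral_def
    by (intro sum.cong refl) (auto simp: prod_measure_def split: if_splits)
  also have "\<dots> = (\<Sum>x\<in>?S. \<Sum>u'\<in>?A. \<Sum>v'\<in>?B. K1 (restrict x F) u' * K2 (restrict x G) v'
        * (\<mu> (restrict x F) * \<nu> (restrict x G)) * (\<mu> u' * \<nu> v'))"
    by (intro sum.cong refl sum_supp_prod_measure[OF disj \<mu> \<nu>])
  also have "\<dots> = (\<Sum>u\<in>?A. \<Sum>v\<in>?B. \<Sum>u'\<in>?A. \<Sum>v'\<in>?B.
      K1 u u' * K2 v v' * (\<mu> u * \<nu> v) * (\<mu> u' * \<nu> v'))"
    by (rule sum_supp_prod_measure[OF disj \<mu> \<nu>])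
  also have "\<dots> = (\<Sum>u\<in>?A. \<Sum>v\<in>?B. (\<Sum>u'\<in>?A. K1 u u' * \<mu> u * \<mu> u') * (\<Sum>v'\<in>?B. K2 v v' * \<nu> v * \<nu> v'))"
    unfolding sum_product by (intro sum.cong refl) (simp add: mult_ac)
  also have "\<dots> = double_integral K1 \<mu> * double_integral K2 \<nu>"
    unfolding double_integral_def sum_product ..
  finally show ?thesis .
qed

text \<open>The cardinality bound in \<open>M2\<close> allows at most one index with
  \<open>A i \<noteq> X i\<close>. If no such index lies in \<open>G\<close>, the factor of \<nu> is
  its total mass, which is zero. If it lies in \<open>G\<close>, the factor of \<mu> is its total
  mass, and either this vanishes or the defining condition of \<open>M2 G X\<close> applies to
  \<nu>.\<close>

lemma prod_measure_M2:
  assumes disj: "F \<inter> G = {}"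
    and \<mu>: "\<mu> \<in> discrete_measures (PiE F X)" and \<nu>: "\<nu> \<in> discrete_measures (PiE G X)"
    and fin: "finite F" "finite G"
    and G0: "mass \<nu> (PiE G X) = 0"
    and or: "mass \<mu> (PiE F X) = 0 \<or> \<nu> \<in> M2 G X"
  shows "prod_measure F G \<mu> \<nu> \<in> M2 (F \<union> G) X"
proof -
  have "mass \<mu> (PiE F A) * mass \<nu> (PiE G A) = 0"
    if sub: "\<forall>i\<in>F \<union> G. A i \<subseteq> X i"
      and card: "card (F \<union> G) \<le> card {i \<in> F \<union> G. A i = X i} + 1" for A
  proof (cases "\<forall>i\<in>G. A i = X i")
    case True
    then have "PiE G A = PiE G X" by (intro PiE_cong) auto
    with G0 show ?thesis by simp
  next
    case False
    then obtain j where j: "j \<in> G" "A j \<noteq> X j" by auto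
    have F: "A i = X i" if "i \<in> F" for i
    proof (rule ccontr)
      \<comment> \<open>Another exceptional index \<open>i\<close> in \<open>F\<close> would leave
        at most \<open>card (F \<union> G) - 2\<close> indices with \<open>A i = X i\<close>, one
        fewer than the bound demands.\<close>
      assume "A i \<noteq> X i"
      then have "{i \<in> F \<union> G. A i = X i} \<subseteq> F \<union> G - {i, j}" using j by auto
      then have "card {i \<in> F \<union> G. A i = X i} \<le> card (F \<union> G - {i, j})"
        using fin by (intro card_mono) auto
      also have "\<dots> = card (F \<union> G) - card {i, j}"
        using that j fin by (intro card_Diff_subset) auto
      also have ij: "card {i, j} = 2" using that j disj by (subst card_2_iff) blast
      finally have "card {i \<in> F \<union> G. A i = X i} \<le> card (F \<union> G) - 2" .
      moreover have "card (F \<union> G) \<ge> card {i, j}"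
        using that j fin by (intro card_mono) auto
      ultimately show False using card ij by linarith
    qed
    then have PF: "PiE F A = PiE F X" by (intro PiE_cong) auto
    \<comment> \<open>All of \<open>F\<close> counts on both sides of the bound and cancels, which
      leaves the bound for \<open>G\<close> alone.\<close>
    have "{i \<in> F \<union> G. A i = X i} = F \<union> {i \<in> G. A i = X i}" using F by auto
    then have "card {i \<in> F \<union> G. A i = X i} = card F + card {i \<in> G. A i = X i}"
      using fin disj by (auto intro!: card_Un_disjoint)
    moreover have "card (F \<union> G) = card F + card G"
      using fin disj by (rule card_Un_disjoint)
    ultimately have "card G \<le> card {i \<in> G. A i = X i} + 1" using card by linarith
    then have "mass \<nu> (PiE G A) = 0" if "\<nu> \<in> M2 G X" using that sub by (simp add: M2_def)
    with or PF show ?thesis by auto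
  qed
  then show ?thesis using prod_measure_discrete[OF disj \<mu> \<nu>]
    by (simp add: M2_def mass_prod_measure[OF disj \<mu> \<nu>])
qed

lemma M2_mass_zero: "\<mu> \<in> M2 I X \<Longrightarrow> mass \<mu> (PiE I X) = 0"
  by (simp add: M2_def)

section \<open>Existence of nonzero test measures\<close>

lemma exists_mass_zero:
  assumes "a \<in> S" "b \<in> S" "a \<noteq> b"
  shows "\<exists>\<mu>\<in>discrete_measures S. \<mu> \<noteq> (\<lambda>_. 0) \<and> mass \<mu> S = 0"
proof -
  define \<mu> :: "'a \<Rightarrow> real" where "\<mu> = (\<lambda>x. of_bool (x = a) - of_bool (x = b))"
  have supp: "{x. \<mu> x \<noteq> 0} \<subseteq> {a, b}" by (auto simp: \<mu>_def)
  have "mass \<mu> S = 0" using assms by (subst mass_superset[OF _ supp]) (auto simp: \<mu>_def)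
  moreover have "\<mu> \<in> discrete_measures S"
    using assms finite_subset[OF supp] supp by (auto simp: discrete_measures_def)
  moreover have "\<mu> a \<noteq> 0" using assms by (simp add: \<mu>_def)
  ultimately show ?thesis by (intro bexI[of _ \<mu>]) auto
qed

text \<open>Changing one coordinate gives two distinct points, and the difference of their Dirac
  measures has mass zero. The second value of that coordinate comes from the factor not being a
  singleton.\<close>

lemma exists_mass_zero_PiE:
  assumes "\<And>i. i \<in> I \<Longrightarrow> X i \<noteq> {}" "\<And>i. i \<in> I \<Longrightarrow> \<not> is_singleton (X i)" "I \<noteq> {}"
  shows "\<exists>\<mu>\<in>discrete_measures (PiE I X). \<mu> \<noteq> (\<lambda>_. 0) \<and> mass \<mu> (PiE I X) = 0"
proof -
  obtain p where p: "p \<in> I" using assms(3) by auto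
  have "PiE I X \<noteq> {}" using assms(1) by (simp add: PiE_eq_empty_iff)
  then obtain a where a: "a \<in> PiE I X" by blast
  then have "a p \<in> X p" using p by auto
  then obtain c where c: "c \<in> X p" "c \<noteq> a p" using assms(2)[OF p] is_singletonI'[of "X p"] by blast
  then have "a(p := c) \<in> PiE I X" "a \<noteq> a(p := c)"
    using a p by (auto simp: PiE_iff extensional_def fun_eq_iff)
  with a show ?thesis by (intro exists_mass_zero)
qed

text \<open>Splitting off one index \<open>p\<close>, the product of mass zero measures on
  \<open>{p}\<close> and on the remaining indices lies in \<open>M2\<close>. Over a single index
  every set \<open>A\<close> is a test set of \<open>M2\<close>, which leaves only the zero measure;
  hence the bound on \<open>card I\<close>.\<close>

lemma exists_M2_nonzero:
  assumes X: "\<And>i. i \<in> I \<Longrightarrow> X i \<noteq> {}" "\<And>i. i \<in> I \<Longrightarrow> \<not> is_singleton (X i)"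
    and I: "card I \<ge> 2"
  shows "\<exists>\<mu>\<in>M2 I X. \<mu> \<noteq> (\<lambda>_. 0)"
proof -
  have fin: "finite I" using I card.infinite by fastforce
  obtain p where p: "p \<in> I" using I by fastforce
  have "card (I - {p}) \<noteq> 0" using I p fin by simp
  then have ne: "I - {p} \<noteq> {}" by (rule contrapos_nn) (simp only: card.empty)
  obtain \<mu> where \<mu>: "\<mu> \<in> discrete_measures (PiE {p} X)" "\<mu> \<noteq> (\<lambda>_. 0)" "mass \<mu> (PiE {p} X) = 0"
    using exists_mass_zero_PiE[of "{p}" X] X p by auto
  obtain \<nu> where \<nu>: "\<nu> \<in> discrete_measures (PiE (I - {p}) X)" "\<nu> \<noteq> (\<lambda>_. 0)"
      "mass \<nu> (PiE (I - {p}) X) = 0"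
    using exists_mass_zero_PiE[of "I - {p}" X] X ne by auto
  have "{p} \<union> (I - {p}) = I" using p by auto
  moreover have "prod_measure {p} (I - {p}) \<mu> \<nu> \<in> M2 ({p} \<union> (I - {p})) X"
    using \<mu> \<nu> fin by (intro prod_measure_M2[of _ _ _ X]) auto
  ultimately have "prod_measure {p} (I - {p}) \<mu> \<nu> \<in> M2 I X" by (simp only:)
  moreover have "prod_measure {p} (I - {p}) \<mu> \<nu> \<noteq> (\<lambda>_. 0)"
    using \<mu> \<nu> by (intro prod_measure_nonzero[of _ _ _ X]) auto
  ultimately show ?thesis by blast
qed

section \<open>Product kernels with at least two indices outside every block\<close>

lemma SPDI2_iff_pos:
  "SPDI2 I X K \<longleftrightarrow> coordinate_symmetric I X K \<and>
     (\<forall>\<mu>\<in>M2 I X. \<mu> \<noteq> (\<lambda>_. 0) \<longrightarrow> double_integral K \<mu> > 0)"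
proof -
  have "double_integral K \<mu> \<ge> 0 \<and> (double_integral K \<mu> = 0 \<longrightarrow> \<mu> = (\<lambda>_. 0)) \<longleftrightarrow>
      (\<mu> \<noteq> (\<lambda>_. 0) \<longrightarrow> double_integral K \<mu> > 0)" for \<mu>
    by (cases "\<mu> = (\<lambda>_. 0)") (auto simp: less_le double_integral_def)
  then show ?thesis by (simp add: SPDI2_def)
qed

text \<open>The source of all necessary conditions: with the measure on one block fixed, the form of
  the other factor has a constant strict sign on all measures that may be paired with it.\<close>

lemma SPDI2_prod_pos:
  assumes SPDI2: "SPDI2 (F \<union> G) X
      (\<lambda>x y. K1 (restrict x F) (restrict y F) * K2 (restrict x G) (restrict y G))"
    and disj: "F \<inter> G = {}" and fin: "finite F" "finite G"
    and \<mu>: "\<mu> \<in> discrete_measures (PiE F X)" "\<mu> \<noteq> (\<lambda>_. 0)"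
    and \<nu>: "\<nu> \<in> discrete_measures (PiE G X)" "\<nu> \<noteq> (\<lambda>_. 0)" "mass \<nu> (PiE G X) = 0"
    and or: "mass \<mu> (PiE F X) = 0 \<or> \<nu> \<in> M2 G X"
  shows "double_integral K1 \<mu> * double_integral K2 \<nu> > 0"
  unfolding double_integral_prod_measure[OF disj \<mu>(1) \<nu>(1), symmetric]
  using SPDI2 prod_measure_M2[OF disj \<mu>(1) \<nu>(1) fin \<nu>(3) or]
    prod_measure_nonzero[OF disj \<mu>(1) \<nu>(1) \<mu>(2) \<nu>(2)]
  by (simp add: SPDI2_iff_pos)

text \<open>The choice \<open>J = F\<close> interchanges the two points as a whole.\<close>

lemma coordinate_symmetric_imp_symmetric_kernel:
  assumes "coordinate_symmetric F X K"
  shows "symmetric_kernel (PiE F X) K"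
  unfolding symmetric_kernel_def
proof (intro ballI)
  fix u v assume uv: "u \<in> PiE F X" "v \<in> PiE F X"
  then have "override_on u v F = v" "override_on v u F = u"
    by (auto simp: fun_eq_iff override_on_def PiE_iff extensional_def)
  moreover have "K (override_on u v F) (override_on v u F) = K u v"
    using assms uv unfolding coordinate_symmetric_def by blast
  ultimately show "K u v = K v u" by simp
qed

lemma symmetric_kernel_scale: "symmetric_kernel S K \<Longrightarrow> symmetric_kernel S (\<lambda>u v. c * K u v)"
  by (simp add: symmetric_kernel_def)

lemma coordinate_symmetric_prod:
  fixes K :: "'j \<Rightarrow> ('i \<Rightarrow> 'a) \<Rightarrow> ('i \<Rightarrow> 'a) \<Rightarrow> real"
  assumes "\<And>j. j \<in> J \<Longrightarrow> coordinate_symmetric (F j) X (K j)"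
  shows "coordinate_symmetric (\<Union>j\<in>J. F j) X
           (\<lambda>x y. \<Prod>j\<in>J. K j (restrict x (F j)) (restrict y (F j)))"
  unfolding coordinate_symmetric_def
proof (intro ballI allI impI prod.cong refl)
  fix u v L j
  assume uv: "u \<in> PiE (\<Union>j\<in>J. F j) X" "v \<in> PiE (\<Union>j\<in>J. F j) X" and j: "j \<in> J"
  \<comment> \<open>Interchanging the coordinates in \<open>L\<close> acts on block \<open>j\<close>
    as interchanging those in \<open>L \<inter> F j\<close>.\<close>
  have r: "restrict (override_on x y L) (F j)
      = override_on (restrict x (F j)) (restrict y (F j)) (L \<inter> F j)" for x y :: "'i \<Rightarrow> 'a"
    by (auto simp: fun_eq_iff override_on_def)
  have "restrict u (F j) \<in> PiE (F j) X" "restrict v (F j) \<in> PiE (F j) X"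
    using uv j by (auto simp: PiE_iff)
  then show "K j (restrict (override_on u v L) (F j)) (restrict (override_on v u L) (F j))
      = K j (restrict u (F j)) (restrict v (F j))"
    using assms[OF j] unfolding r coordinate_symmetric_def by blast
qed

lemma SPD_tensor:
  assumes SPD: "SPD (PiE F X) K1" "SPD (PiE G X) K2" and disj: "F \<inter> G = {}"
  shows "SPD (PiE (F \<union> G) X)
    (\<lambda>x y. K1 (restrict x F) (restrict y F) * K2 (restrict x G) (restrict y G))"
proof -
  have "symmetric_kernel (PiE (F \<union> G) X)
    (\<lambda>x y. K1 (restrict x F) (restrict y F) * K2 (restrict x G) (restrict y G))"
    unfolding symmetric_kernel_def
  proof (intro ballI)
    fix u v assume "u \<in> PiE (F \<union> G) X" "v \<in> PiE (F \<union> G) X"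
    then have "restrict u F \<in> PiE F X" "restrict v F \<in> PiE F X"
      "restrict u G \<in> PiE G X" "restrict v G \<in> PiE G X" by (simp_all only: mem_PiE_Un_iff)
    then have "K1 (restrict u F) (restrict v F) = K1 (restrict v F) (restrict u F)"
      "K2 (restrict u G) (restrict v G) = K2 (restrict v G) (restrict u G)"
      using SPD by (simp_all only: SPD_def symmetric_kernel_def)
    then show "K1 (restrict u F) (restrict v F) * K2 (restrict u G) (restrict v G)
        = K1 (restrict v F) (restrict u F) * K2 (restrict v G) (restrict u G)" by simp
  qed
  then show ?thesis
    using SPD double_integral_tensor_pos[where ?cond1.0 = False and ?cond2.0 = False, OF _ _ disj]
    unfolding SPD_iff_strictly_PD strictly_PD_def by blast
qed

lemma SPD_prod:
  fixes K :: "'j \<Rightarrow> ('i \<Rightarrow> 'a) \<Rightarrow> ('i \<Rightarrow> 'a) \<Rightarrow> real"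
  assumes "finite J" "disjoint_family_on F J" "\<And>j. j \<in> J \<Longrightarrow> SPD (PiE (F j) X) (K j)"
  shows "SPD (PiE (\<Union>j\<in>J. F j) X)
           (\<lambda>x y. \<Prod>j\<in>J. K j (restrict x (F j)) (restrict y (F j)))"
  using assms
proof (induction J rule: finite_induct)
  case empty
  \<comment> \<open>The product over no index is a single point and the empty product kernel is
    \<open>1\<close>, so the form is the square of the one point mass.\<close>
  have "double_integral (\<lambda>x y. 1) \<mu> > 0"
    if "\<mu> \<in> discrete_measures (PiE {} X)" "\<mu> \<noteq> (\<lambda>_. 0)" for \<mu> :: "('i \<Rightarrow> 'a) \<Rightarrow> real"
  proof -
    have "{x. \<mu> x \<noteq> 0} \<subseteq> {\<lambda>_. undefined}" using that(1) by (simp add: discrete_measures_def)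
    moreover have "{x. \<mu> x \<noteq> 0} \<noteq> {}" using that(2) by auto
    ultimately have "{x. \<mu> x \<noteq> 0} = {\<lambda>_. undefined}" "\<mu> (\<lambda>_. undefined) \<noteq> 0" by blast+
    then show ?thesis by (auto simp: double_integral_def zero_less_mult_iff)
  qed
  then show ?case by (simp add: SPD_def symmetric_kernel_def)
next
  case (insert j J)
  let ?G = "\<Union>j\<in>J. F j"
  have disj: "F j \<inter> ?G = {}"
    using insert.hyps insert.prems(1) by (fastforce simp: disjoint_family_on_def)
  have "restrict (restrict x ?G) (F i) = restrict x (F i)" if "i \<in> J" for i and x :: "'i \<Rightarrow> 'a"
    using that by (auto simp: fun_eq_iff restrict_def)
  then have eq: "(\<Prod>i\<in>J. K i (restrict (restrict x ?G) (F i)) (restrict (restrict y ?G) (F i)))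
      = (\<Prod>i\<in>J. K i (restrict x (F i)) (restrict y (F i)))" for x y
    by (intro prod.cong) auto
  have "SPD (PiE ?G X) (\<lambda>x y. \<Prod>i\<in>J. K i (restrict x (F i)) (restrict y (F i)))"
    using insert.prems by (intro insert.IH disjoint_family_on_mono[of J "insert j J"]) auto
  from SPD_tensor[OF insert.prems(2)[OF insertI1] this disj] show ?case
    unfolding UN_insert prod.insert[OF insert.hyps] eq .
qed

text \<open>A nonzero \<nu> in \<open>M2 G X\<close> can be paired with every measure on
  \<open>F\<close>, so the sign of \<open>K1\<close> on all of them is that of the fixed number
  \<open>double_integral K2 \<nu>\<close>.\<close>

lemma SPD_factor_up_to_sign:
  assumes SPDI2: "SPDI2 (F \<union> G) X
      (\<lambda>x y. K1 (restrict x F) (restrict y F) * K2 (restrict x G) (restrict y G))"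
    and disj: "F \<inter> G = {}" and fin: "finite F" "finite G" and card: "card G \<ge> 2"
    and X: "\<And>i. i \<in> G \<Longrightarrow> X i \<noteq> {}" "\<And>i. i \<in> G \<Longrightarrow> \<not> is_singleton (X i)"
    and sym: "symmetric_kernel (PiE F X) K1"
  shows "\<exists>a\<in>{0, 1::nat}. SPD (PiE F X) (\<lambda>u v. (-1) ^ a * K1 u v)"
proof -
  obtain \<nu> where \<nu>: "\<nu> \<in> M2 G X" "\<nu> \<noteq> (\<lambda>_. 0)" using exists_M2_nonzero[of G X] X card by blast
  have pos: "double_integral K1 \<mu> * double_integral K2 \<nu> > 0"
    if "\<mu> \<in> discrete_measures (PiE F X)" "\<mu> \<noteq> (\<lambda>_. 0)" for \<mu>
    using SPDI2_prod_pos[OF SPDI2 disj fin that _ \<nu>(2) M2_mass_zero[OF \<nu>(1)]] \<nu>(1)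
    by (simp add: M2_def)
  define a :: nat where "a = (if double_integral K2 \<nu> > 0 then 0 else 1)"
  have "(-1) ^ a * double_integral K1 \<mu> > 0"
    if "\<mu> \<in> discrete_measures (PiE F X)" "\<mu> \<noteq> (\<lambda>_. 0)" for \<mu>
    using pos[OF that] by (auto simp: a_def zero_less_mult_iff)
  then have "SPD (PiE F X) (\<lambda>u v. (-1) ^ a * K1 u v)"
    using sym by (simp add: SPD_def double_integral_scale symmetric_kernel_scale)
  moreover have "a \<in> {0, 1}" by (simp add: a_def)
  ultimately show ?thesis by blast
qed

text \<open>Necessity takes each block against the product of all others, whose indices number at
  least two. Sufficiency is the tensor product of SPD kernels, where the signs multiply to
  \<open>1\<close> for an even sum.\<close>

lemma SPDI2_iff_SPD_factors:
  fixes K :: "'j \<Rightarrow> ('i \<Rightarrow> 'a) \<Rightarrow> ('i \<Rightarrow> 'a) \<Rightarrow> real" and F :: "'j \<Rightarrow> 'i set"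
  assumes I_def: "I = (\<Union>j\<in>J. F j)" and J: "finite J" "J \<noteq> {}"
    and fin: "finite I" and disj: "disjoint_family_on F J"
    and X: "\<And>i. i \<in> I \<Longrightarrow> X i \<noteq> {}" "\<And>i. i \<in> I \<Longrightarrow> \<not> is_singleton (X i)"
    and sym: "\<And>j. j \<in> J \<Longrightarrow> coordinate_symmetric (F j) X (K j)"
    and card: "\<And>j. j \<in> J \<Longrightarrow> card (I - F j) \<ge> 2"
  shows "SPDI2 I X (\<lambda>x y. \<Prod>j\<in>J. K j (restrict x (F j)) (restrict y (F j))) \<longleftrightarrow>
    (\<exists>a :: 'j \<Rightarrow> nat. (\<forall>j\<in>J. a j \<in> {0, 1} \<and> SPD (PiE (F j) X) (\<lambda>u v. (-1) ^ a j * K j u v))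
       \<and> even (\<Sum>j\<in>J. a j))"
    (is "SPDI2 I X ?K \<longleftrightarrow> ?R")
proof -
  have SPD_signed: "SPD (PiE I X) (\<lambda>x y. (-1) ^ (\<Sum>j\<in>J. a j) * ?K x y)"
    if "\<forall>j\<in>J. SPD (PiE (F j) X) (\<lambda>u v. (-1) ^ a j * K j u v)" for a :: "'j \<Rightarrow> nat"
    using SPD_prod[OF J(1) disj, of X "\<lambda>j u v. (-1) ^ a j * K j u v"] that
    by (simp add: I_def prod.distrib power_sum)
  show ?thesis
  proof
    assume L: "SPDI2 I X ?K"
    have "\<exists>a\<in>{0, 1::nat}. SPD (PiE (F j) X) (\<lambda>u v. (-1) ^ a * K j u v)" if j: "j \<in> J" for j
    proof (rule SPD_factor_up_to_sign)
      \<comment> \<open>The factors other than \<open>j\<close> form one kernel on the complement of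
        \<open>F j\<close>; restricting to \<open>G\<close> first does not change their
        arguments.\<close>
      define G where "G = I - F j"
      have Fj: "F j \<subseteq> I" using j by (auto simp: I_def)
      have sub: "F i \<subseteq> G" if "i \<in> J - {j}" for i
        using that j disj unfolding I_def G_def disjoint_family_on_def by fast
      have r: "restrict (restrict x G) (F i) = restrict x (F i)"
        if "i \<in> J - {j}" for i and x :: "'i \<Rightarrow> 'a"
        by (simp add: Int_absorb1[OF sub[OF that]])
      have "(\<Prod>i\<in>J - {j}. K i (restrict (restrict x G) (F i)) (restrict (restrict y G) (F i)))
          = (\<Prod>i\<in>J - {j}. K i (restrict x (F i)) (restrict y (F i)))" for x y
        by (rule prod.cong) (simp_all only: r)
      then have "?K = (\<lambda>x y. K j (restrict x (F j)) (restrict y (F j)) *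
          (\<Prod>i\<in>J - {j}. K i (restrict (restrict x G) (F i)) (restrict (restrict y G) (F i))))"
        by (simp only: fun_eq_iff prod.remove[OF J(1) j]) simp
      moreover have "F j \<union> G = I" using Fj by (auto simp: G_def)
      ultimately show "SPDI2 (F j \<union> G) X (\<lambda>x y. K j (restrict x (F j)) (restrict y (F j)) *
          (\<lambda>u v. \<Prod>i\<in>J - {j}. K i (restrict u (F i)) (restrict v (F i))) (restrict x G) (restrict y G))"
        using L by simp
      show "F j \<inter> G = {}" "finite (F j)" "finite G"
        using fin finite_subset[OF Fj] by (auto simp: G_def)
      show "card G \<ge> 2" unfolding G_def by (rule card[OF j])
      show "symmetric_kernel (PiE (F j) X) (K j)"
        by (rule coordinate_symmetric_imp_symmetric_kernel[OF sym[OF j]])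
    qed (use X in auto)
    then have "\<forall>j\<in>J. \<exists>a::nat. a \<in> {0, 1} \<and> SPD (PiE (F j) X) (\<lambda>u v. (-1) ^ a * K j u v)" by blast
    then obtain a :: "'j \<Rightarrow> nat" where
      a: "\<forall>j\<in>J. a j \<in> {0, 1} \<and> SPD (PiE (F j) X) (\<lambda>u v. (-1) ^ a j * K j u v)"
      by (rule bchoice[THEN exE])
    obtain j where "j \<in> J" using J by auto
    then have "card I \<ge> 2" using card[of j] card_mono[OF fin, of "I - F j"] by fastforce
    \<comment> \<open>Parity comes from a single nonzero \<nu> in \<open>M2 I X\<close>: its
      integral is positive both with and without the factor
      \<open>(-1) ^ (\<Sum>j\<in>J. a j)\<close>.\<close>
    then obtain \<nu> where \<nu>: "\<nu> \<in> M2 I X" "\<nu> \<noteq> (\<lambda>_. 0)" using exists_M2_nonzero[of I X] X by blast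
    then have "double_integral ?K \<nu> > 0" using L by (simp add: SPDI2_iff_pos)
    moreover have "(-1) ^ (\<Sum>j\<in>J. a j) * double_integral ?K \<nu> > 0"
      using SPD_signed[of a] a \<nu> by (simp add: SPD_def M2_def double_integral_scale)
    ultimately have "even (\<Sum>j\<in>J. a j)" by (cases "even (\<Sum>j\<in>J. a j)") auto
    with a show ?R by blast
  next
    assume ?R
    then obtain a :: "'j \<Rightarrow> nat" where
      a: "\<forall>j\<in>J. SPD (PiE (F j) X) (\<lambda>u v. (-1) ^ a j * K j u v)" "even (\<Sum>j\<in>J. a j)" by blast
    have "double_integral ?K \<mu> > 0" if "\<mu> \<in> M2 I X" "\<mu> \<noteq> (\<lambda>_. 0)" for \<mu>
      using SPD_signed[OF a(1)] a(2) that by (simp add: SPD_def M2_def)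
    moreover have "coordinate_symmetric I X ?K"
      unfolding I_def using sym by (rule coordinate_symmetric_prod)
    ultimately show "SPDI2 I X ?K" by (simp add: SPDI2_iff_pos)
  qed
qed

section \<open>Two blocks, one of them a single index\<close>

lemma strictly_PD_of_sign:
  assumes "symmetric_kernel S K"
    and "\<And>\<mu>. \<mu> \<in> discrete_measures S \<Longrightarrow> \<mu> \<noteq> (\<lambda>_. 0) \<Longrightarrow> cond \<longrightarrow> mass \<mu> S = 0 \<Longrightarrow>
           c * double_integral K \<mu> > 0"
  shows "strictly_PD cond S (\<lambda>u v. c * K u v)"
  using assms by (simp add: strictly_PD_def double_integral_scale symmetric_kernel_scale)

text \<open>Measures in \<open>M2\<close> have mass zero on every slice that fixes one coordinate.
  The fibres over \<open>{j}\<close> are such slices, so conditional definiteness of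
  \<open>K1\<close> is enough. The fibres over \<open>F\<close> are such slices when
  \<open>F\<close> is a single index, which is when \<open>K2\<close> may be conditional
  too.\<close>

lemma SPDI2_of_strictly_PD_pair:
  assumes sym: "coordinate_symmetric (F \<union> {j}) X
      (\<lambda>x y. K1 (restrict x F) (restrict y F) * K2 (restrict x {j}) (restrict y {j}))"
    and K1: "strictly_PD True (PiE F X) (\<lambda>u v. (-1) ^ a * K1 u v)"
    and K2: "strictly_PD cond (PiE {j} X) (\<lambda>u v. (-1) ^ a * K2 u v)"
    and F: "j \<notin> F" "finite F" "cond \<Longrightarrow> card F = 1"
  shows "SPDI2 (F \<union> {j}) X
      (\<lambda>x y. K1 (restrict x F) (restrict y F) * K2 (restrict x {j}) (restrict y {j}))"
    (is "SPDI2 ?I X ?K")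
proof -
  have section_mass: "mass \<mu> {x \<in> PiE ?I X. restrict x {i} = u} = 0"
    if \<mu>: "\<mu> \<in> M2 ?I X" and i: "i \<in> ?I" and u: "u \<in> PiE {i} X" for \<mu> i u
  proof -
    \<comment> \<open>The slice is a box that differs from the full product at most in coordinate
      \<open>i\<close>, hence a test set of \<open>M2\<close>.\<close>
    have "{x \<in> PiE ?I X. restrict x {i} = u} = PiE ?I (X(i := {u i}))"
    proof (intro set_eqI iffI)
      fix x assume "x \<in> {x \<in> PiE ?I X. restrict x {i} = u}"
      then show "x \<in> PiE ?I (X(i := {u i}))" by (auto simp: PiE_iff)
    next
      fix x assume x: "x \<in> PiE ?I (X(i := {u i}))"
      then have "x i = u i" using i by (auto simp: PiE_iff)
      moreover have "u k = undefined" if "k \<noteq> i" for k using u that by (auto simp: PiE_iff extensional_def)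
      ultimately have "restrict x {i} = u" by (auto simp: fun_eq_iff)
      moreover have "x \<in> PiE ?I X"
        unfolding PiE_iff
      proof (intro conjI ballI)
        fix k assume "k \<in> ?I"
        then show "x k \<in> X k" using x u \<open>x i = u i\<close> by (cases "k = i") (auto simp: PiE_iff)
      qed (use x in \<open>auto simp: PiE_iff\<close>)
      ultimately show "x \<in> {x \<in> PiE ?I X. restrict x {i} = u}" by simp
    qed
    moreover have "mass \<mu> (PiE ?I (X(i := {u i}))) = 0"
    proof -
      have "?I - {i} \<subseteq> {k \<in> ?I. (X(i := {u i})) k = X k}" by auto
      then have "card (?I - {i}) \<le> card {k \<in> ?I. (X(i := {u i})) k = X k}"
        using F(2) by (intro card_mono) auto
      then have "card ?I \<le> card {k \<in> ?I. (X(i := {u i})) k = X k} + 1"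
        using i F(2) by (simp add: card_Diff_singleton_if split: if_splits)
      moreover have "\<forall>k\<in>?I. (X(i := {u i})) k \<subseteq> X k" using u by (auto simp: PiE_iff)
      ultimately show ?thesis using \<mu> unfolding M2_def by blast
    qed
    ultimately show ?thesis by simp
  qed
  have "double_integral ?K \<mu> > 0" if \<mu>: "\<mu> \<in> M2 ?I X" "\<mu> \<noteq> (\<lambda>_. 0)" for \<mu>
  proof -
    have "double_integral (\<lambda>x y. (-1) ^ a * K1 (restrict x F) (restrict y F)
        * ((-1) ^ a * K2 (restrict x {j}) (restrict y {j}))) \<mu> > 0"
    proof (rule double_integral_tensor_pos[OF K1 K2])
      show "F \<inter> {j} = {}" using F by auto
      show "\<mu> \<in> discrete_measures (PiE ?I X)" using \<mu> by (simp add: M2_def)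
      show "mass \<mu> {x \<in> PiE ?I X. restrict x {j} = v} = 0" if "v \<in> PiE {j} X" for v
        using section_mass[OF \<mu>(1), of j] that by simp
      show "mass \<mu> {x \<in> PiE ?I X. restrict x F = u} = 0" if c: cond and u: "u \<in> PiE F X" for u
      proof -
        obtain i where "F = {i}" using F(3)[OF c] by (elim card_1_singletonE)
        then show ?thesis using section_mass[OF \<mu>(1), of i] u by simp
      qed
    qed fact
    moreover have "(-1) ^ a * r * ((-1) ^ a * s) = r * s" for r s :: real
      by (cases "even a") auto
    ultimately show ?thesis by simp
  qed
  with sym show ?thesis by (simp add: SPDI2_iff_pos)
qed

text \<open>Carries a known sign from one block to the other: a nonzero mass zero measure on
  \<open>G\<close> has the sign of \<open>K2\<close> and can be paired with every mass zero measure
  on \<open>F\<close>.\<close>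

lemma SPDI2_pair_conditional_sign:
  assumes SPDI2: "SPDI2 (F \<union> G) X
      (\<lambda>x y. K1 (restrict x F) (restrict y F) * K2 (restrict x G) (restrict y G))"
    and disj: "F \<inter> G = {}" and fin: "finite F" "finite G" and ne: "G \<noteq> {}"
    and X: "\<And>i. i \<in> G \<Longrightarrow> X i \<noteq> {}" "\<And>i. i \<in> G \<Longrightarrow> \<not> is_singleton (X i)"
    and sym: "symmetric_kernel (PiE F X) K1"
    and K2: "strictly_PD True (PiE G X) (\<lambda>u v. (-1) ^ (a::nat) * K2 u v)"
  shows "strictly_PD True (PiE F X) (\<lambda>u v. (-1) ^ a * K1 u v)"
proof (rule strictly_PD_of_sign[OF sym])
  obtain \<nu> where \<nu>: "\<nu> \<in> discrete_measures (PiE G X)" "\<nu> \<noteq> (\<lambda>_. 0)" "mass \<nu> (PiE G X) = 0"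
    using exists_mass_zero_PiE[of G X] X ne by blast
  then have "(-1) ^ a * double_integral K2 \<nu> > 0"
    using K2 by (simp add: strictly_PD_def double_integral_scale)
  moreover fix \<mu>
  assume "\<mu> \<in> discrete_measures (PiE F X)" "\<mu> \<noteq> (\<lambda>_. 0)" "True \<longrightarrow> mass \<mu> (PiE F X) = 0"
  then have "double_integral K1 \<mu> * double_integral K2 \<nu> > 0"
    using SPDI2_prod_pos[OF SPDI2 disj fin _ _ \<nu>] by blast
  ultimately show "(-1) ^ a * double_integral K1 \<mu> > 0"
    by (cases "even a") (auto simp: zero_less_mult_iff mult_less_0_iff)
qed

text \<open>Here a nonzero mass zero measure on \<open>F\<close> is fixed and the one on
  \<open>G\<close> varies; the sign of the fixed integral determines \<open>a\<close>.\<close>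

lemma strictly_PD_conditional_up_to_sign:
  assumes SPDI2: "SPDI2 (F \<union> G) X
      (\<lambda>x y. K1 (restrict x F) (restrict y F) * K2 (restrict x G) (restrict y G))"
    and disj: "F \<inter> G = {}" and fin: "finite F" "finite G" and ne: "F \<noteq> {}"
    and X: "\<And>i. i \<in> F \<Longrightarrow> X i \<noteq> {}" "\<And>i. i \<in> F \<Longrightarrow> \<not> is_singleton (X i)"
    and sym: "symmetric_kernel (PiE G X) K2"
  shows "\<exists>a\<in>{0, 1::nat}. strictly_PD True (PiE G X) (\<lambda>u v. (-1) ^ a * K2 u v)"
proof -
  obtain \<mu> where \<mu>: "\<mu> \<in> discrete_measures (PiE F X)" "\<mu> \<noteq> (\<lambda>_. 0)" "mass \<mu> (PiE F X) = 0"
    using exists_mass_zero_PiE[of F X] X ne by blast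
  define a :: nat where "a = (if double_integral K1 \<mu> > 0 then 0 else 1)"
  have "strictly_PD True (PiE G X) (\<lambda>u v. (-1) ^ a * K2 u v)"
  proof (rule strictly_PD_of_sign[OF sym])
    fix \<nu>
    assume "\<nu> \<in> discrete_measures (PiE G X)" "\<nu> \<noteq> (\<lambda>_. 0)" "True \<longrightarrow> mass \<nu> (PiE G X) = 0"
    then have "double_integral K1 \<mu> * double_integral K2 \<nu> > 0"
      using SPDI2_prod_pos[OF SPDI2 disj fin \<mu>(1,2)] \<mu>(3) by blast
    then show "(-1) ^ a * double_integral K2 \<nu> > 0"
      by (auto simp: a_def zero_less_mult_iff)
  qed
  moreover have "a \<in> {0, 1}" by (simp add: a_def)
  ultimately show ?thesis by blast
qed

lemma SPD_imp_strictly_PD: "SPD S \<gamma> \<Longrightarrow> strictly_PD cond S \<gamma>"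
  by (simp add: SPD_def strictly_PD_def)

lemma strictly_CND_sign:
  "strictly_CND S (\<lambda>u v. (-1) ^ (a + 1) * K u v) \<longleftrightarrow> strictly_PD True S (\<lambda>u v. (-1) ^ a * K u v)"
  by (simp add: strictly_CND_iff_strictly_PD)

lemma SPDI2_of_strictly_PD_blocks:
  assumes sym: "coordinate_symmetric (F \<union> G) X
      (\<lambda>x y. K1 (restrict x F) (restrict y F) * K2 (restrict x G) (restrict y G))"
    and K1: "strictly_PD True (PiE F X) (\<lambda>u v. (-1) ^ a * K1 u v)"
    and K2: "strictly_PD cond (PiE G X) (\<lambda>u v. (-1) ^ a * K2 u v)"
    and F: "F \<inter> G = {}" "finite F" "card G = 1" "cond \<Longrightarrow> card F = 1"
  shows "SPDI2 (F \<union> G) X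
      (\<lambda>x y. K1 (restrict x F) (restrict y F) * K2 (restrict x G) (restrict y G))"
proof -
  obtain j where j: "G = {j}" using F(3) by (rule card_1_singletonE)
  then have "j \<notin> F" using F(1) by blast
  from SPDI2_of_strictly_PD_pair[OF sym[unfolded j] K1 K2[unfolded j] this F(2,4)]
  show ?thesis unfolding j .
qed

text \<open>Necessity finds the sign on \<open>G\<close> first and carries it over to
  \<open>F\<close>. Since each block is the complement of a single index, both fibre conditions hold
  in the converse.\<close>

lemma SPDI2_singleton_blocks_iff:
  assumes cs: "coordinate_symmetric (F \<union> G) X
      (\<lambda>x y. K1 (restrict x F) (restrict y F) * K2 (restrict x G) (restrict y G))" (is "coordinate_symmetric _ _ ?K")
    and sym: "symmetric_kernel (PiE F X) K1" "symmetric_kernel (PiE G X) K2"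
    and disj: "F \<inter> G = {}" and card: "card F = 1" "card G = 1"
    and X: "\<And>i. i \<in> F \<union> G \<Longrightarrow> X i \<noteq> {}" "\<And>i. i \<in> F \<union> G \<Longrightarrow> \<not> is_singleton (X i)"
  shows "SPDI2 (F \<union> G) X ?K \<longleftrightarrow> (\<exists>a\<in>{0, 1 :: nat}.
    strictly_PD True (PiE F X) (\<lambda>u v. (-1) ^ a * K1 u v) \<and>
    strictly_PD True (PiE G X) (\<lambda>u v. (-1) ^ a * K2 u v))"
proof
  have fin: "finite F" "finite G" and ne: "F \<noteq> {}" "G \<noteq> {}"
    using card by (auto intro: card_ge_0_finite)
  assume L: "SPDI2 (F \<union> G) X ?K"
  have "\<exists>a\<in>{0, 1::nat}. strictly_PD True (PiE G X) (\<lambda>u v. (-1) ^ a * K2 u v)"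
    by (rule strictly_PD_conditional_up_to_sign[OF L disj fin ne(1) X[OF UnI1] sym(2)])
  then obtain a :: nat where a: "a \<in> {0, 1}" "strictly_PD True (PiE G X) (\<lambda>u v. (-1) ^ a * K2 u v)"
    by (elim bexE)
  have "strictly_PD True (PiE F X) (\<lambda>u v. (-1) ^ a * K1 u v)"
    by (rule SPDI2_pair_conditional_sign[OF L disj fin ne(2) X[OF UnI2] sym(1) a(2)])
  with a show "\<exists>a\<in>{0, 1 :: nat}. strictly_PD True (PiE F X) (\<lambda>u v. (-1) ^ a * K1 u v) \<and>
      strictly_PD True (PiE G X) (\<lambda>u v. (-1) ^ a * K2 u v)"
    by (intro bexI[of _ a] conjI)
next
  have fin: "finite F" using card by (auto intro: card_ge_0_finite)
  assume "\<exists>a\<in>{0, 1 :: nat}. strictly_PD True (PiE F X) (\<lambda>u v. (-1) ^ a * K1 u v) \<and>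
      strictly_PD True (PiE G X) (\<lambda>u v. (-1) ^ a * K2 u v)"
  then obtain a :: nat where
    "strictly_PD True (PiE F X) (\<lambda>u v. (-1) ^ a * K1 u v)"
    "strictly_PD True (PiE G X) (\<lambda>u v. (-1) ^ a * K2 u v)"
    by (elim bexE conjE)
  then show "SPDI2 (F \<union> G) X ?K"
    by (rule SPDI2_of_strictly_PD_blocks[OF cs _ _ disj fin card(2,1)])
qed

text \<open>The blocks differ because \<open>F\<close> has two indices: \<open>M2 F X\<close>
  contains a nonzero measure, against which all measures on \<open>G\<close> may be tested. Opposite
  \<open>F\<close> there is only one index, so \<open>K1\<close> is controlled on mass zero measures
  only.\<close>

lemma SPDI2_one_singleton_block_iff:
  assumes cs: "coordinate_symmetric (F \<union> G) X
      (\<lambda>x y. K1 (restrict x F) (restrict y F) * K2 (restrict x G) (restrict y G))" (is "coordinate_symmetric _ _ ?K")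
    and sym: "symmetric_kernel (PiE F X) K1" "symmetric_kernel (PiE G X) K2"
    and disj: "F \<inter> G = {}" and card: "card F \<ge> 2" "card G = 1"
    and X: "\<And>i. i \<in> F \<union> G \<Longrightarrow> X i \<noteq> {}" "\<And>i. i \<in> F \<union> G \<Longrightarrow> \<not> is_singleton (X i)"
  shows "SPDI2 (F \<union> G) X ?K \<longleftrightarrow> (\<exists>a\<in>{0, 1 :: nat}.
    strictly_PD True (PiE F X) (\<lambda>u v. (-1) ^ a * K1 u v) \<and>
    SPD (PiE G X) (\<lambda>u v. (-1) ^ a * K2 u v))"
proof
  have fin: "finite F" "finite G" and ne: "G \<noteq> {}"
    using card by (auto intro: card_ge_0_finite)
  assume L: "SPDI2 (F \<union> G) X ?K"
  then have L': "SPDI2 (G \<union> F) X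
      (\<lambda>x y. K2 (restrict x G) (restrict y G) * K1 (restrict x F) (restrict y F))"
    by (simp only: mult.commute Un_commute)
  have "G \<inter> F = {}" using disj by blast
  then have "\<exists>a\<in>{0, 1::nat}. SPD (PiE G X) (\<lambda>u v. (-1) ^ a * K2 u v)"
    by (rule SPD_factor_up_to_sign[OF L' _ fin(2,1) card(1) X[OF UnI1] sym(2)])
  then obtain a :: nat where a: "a \<in> {0, 1}" "SPD (PiE G X) (\<lambda>u v. (-1) ^ a * K2 u v)"
    by (elim bexE)
  have "strictly_PD True (PiE F X) (\<lambda>u v. (-1) ^ a * K1 u v)"
    by (rule SPDI2_pair_conditional_sign
        [OF L disj fin ne X[OF UnI2] sym(1) SPD_imp_strictly_PD[OF a(2)]])
  with a show "\<exists>a\<in>{0, 1 :: nat}. strictly_PD True (PiE F X) (\<lambda>u v. (-1) ^ a * K1 u v) \<and>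
      SPD (PiE G X) (\<lambda>u v. (-1) ^ a * K2 u v)"
    by (intro bexI[of _ a] conjI)
next
  have fin: "finite F" using card by (auto intro: card_ge_0_finite)
  assume "\<exists>a\<in>{0, 1 :: nat}. strictly_PD True (PiE F X) (\<lambda>u v. (-1) ^ a * K1 u v) \<and>
      SPD (PiE G X) (\<lambda>u v. (-1) ^ a * K2 u v)"
  then obtain a :: nat where
    "strictly_PD True (PiE F X) (\<lambda>u v. (-1) ^ a * K1 u v)"
    "strictly_PD False (PiE G X) (\<lambda>u v. (-1) ^ a * K2 u v)"
    unfolding SPD_iff_strictly_PD by (elim bexE conjE)
  then show "SPDI2 (F \<union> G) X ?K"
    by (rule SPDI2_of_strictly_PD_blocks[OF cs _ _ disj fin card(2)]) simp
qed

section \<open>Signs, block sizes and the case distinction\<close>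

text \<open>Two further blocks, nonempty and disjoint, supply one index each.\<close>

lemma card_outside_block:
  assumes disj: "disjoint_family_on F J" and fin: "finite (\<Union>j\<in>J. F j)"
    and ne: "\<And>j. j \<in> J \<Longrightarrow> F j \<noteq> {}" and J: "card (J - {i}) \<ge> 2" and i: "i \<in> J"
  shows "card ((\<Union>j\<in>J. F j) - F i) \<ge> 2"
proof -
  obtain T where "T \<subseteq> J - {i}" "card T = 2" using J by (rule obtain_subset_with_card_n)
  then obtain j k where jk: "j \<in> J - {i}" "k \<in> J - {i}" "j \<noteq> k"
    unfolding card_2_iff by blast
  obtain p q where pq: "p \<in> F j" "q \<in> F k" using ne jk by blast
  have "F j \<inter> F k = {}" "F j \<inter> F i = {}" "F k \<inter> F i = {}"
    using disj jk i by (auto simp: disjoint_family_on_def)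
  then have "p \<noteq> q" "p \<notin> F i" "q \<notin> F i" using pq by blast+
  then have "{p, q} \<subseteq> (\<Union>j\<in>J. F j) - F i" "card {p, q} = 2" using jk pq by auto
  then show ?thesis using card_mono[OF _ \<open>{p, q} \<subseteq> _\<close>] fin by simp
qed

text \<open>Two exponents from \<open>{0, 1}\<close> have an even sum only if they agree.\<close>

lemma ex_even_pair_iff:
  fixes P :: "nat \<Rightarrow> nat \<Rightarrow> bool"
  shows "(\<exists>a. (\<forall>i\<in>{1..2}. a i \<in> {0, 1} \<and> P i (a i)) \<and> even (\<Sum>i=1..2. a i)) \<longleftrightarrow>
    (\<exists>c\<in>{0, 1}. \<forall>i\<in>{1..2}. P i c)" (is "?L \<longleftrightarrow> ?R")
proof
  have J: "{1..2::nat} = {1, 2}" by auto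
  assume ?L
  then obtain a where a: "\<forall>i\<in>{1, 2}. a i \<in> {0, 1} \<and> P i (a i)" "even (a 1 + a 2)"
    unfolding J by auto
  then have "a 1 \<in> {0, 1}" "a 2 = a 1" by auto
  then show ?R unfolding J using a(1) by (intro bexI[of _ "a 1"]) auto
next
  assume ?R
  then obtain c where "c \<in> {0, 1}" "\<forall>i\<in>{1..2}. P i c" by blast
  then show ?L by (intro exI[of _ "\<lambda>_. c"]) auto
qed

lemma strictly_CND_common_sign_iff:
  "(\<exists>a\<in>{0, 1 :: nat}. \<forall>i\<in>J. strictly_CND (S i) (\<lambda>u v. (-1) ^ a * K i u v)) \<longleftrightarrow>
   (\<exists>a\<in>{0, 1 :: nat}. \<forall>i\<in>J. strictly_PD True (S i) (\<lambda>u v. (-1) ^ a * K i u v))"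
proof -
  define P where "P a \<longleftrightarrow> (\<forall>i\<in>J. strictly_CND (S i) (\<lambda>u v. (-1) ^ a * K i u v))" for a :: nat
  \<comment> \<open>Exponents matter modulo 2 only, so the shift from \<open>a\<close> to
    \<open>a + 1\<close> permutes the two choices; it absorbs the sign between conditional negative
    and positive definiteness.\<close>
  have "P (Suc (Suc 0)) \<longleftrightarrow> P 0" by (simp add: P_def)
  then have "(\<exists>a\<in>{0, 1}. P a) \<longleftrightarrow> (\<exists>a\<in>{0, 1}. P (a + 1))" by auto
  then show ?thesis unfolding P_def strictly_CND_sign .
qed

theorem corollary45:
  fixes n l :: nat
    and X :: "nat \<Rightarrow> 'a set"
    and F :: "nat \<Rightarrow> nat set"
    and K :: "nat \<Rightarrow> (nat \<Rightarrow> 'a) \<Rightarrow> (nat \<Rightarrow> 'a) \<Rightarrow> real"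
  defines "\<I> \<equiv> \<lambda>x y. \<Prod>i=1..l. K i (restrict x (F i)) (restrict y (F i))"
  assumes "n \<ge> 2" and "l \<ge> 2"
    and "\<And>i. i \<in> {1..n} \<Longrightarrow> X i \<noteq> {}"
    and "\<And>i. i \<in> {1..n} \<Longrightarrow> \<not> is_singleton (X i)"
    and "disjoint_family_on F {1..l}"
    and "(\<Union>i\<in>{1..l}. F i) = {1..n}"
    and "\<And>i. i \<in> {1..l} \<Longrightarrow> F i \<noteq> {}"
    and "antimono_on {1..l} (\<lambda>i. card (F i))"
    and "\<And>i. i \<in> {1..l} \<Longrightarrow> coordinate_symmetric (F i) X (K i)"
  shows "(l > 2 \<longrightarrow>
           (SPDI2 {1..n} X \<I> \<longleftrightarrow>
             (\<exists>a :: nat \<Rightarrow> nat.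
               (\<forall>i\<in>{1..l}. a i \<in> {0, 1} \<and> SPD (PiE (F i) X) (\<lambda>u v. (-1) ^ a i * K i u v)) \<and>
               even (\<Sum>i=1..l. a i))))
       \<and> (l = 2 \<and> n = 2 \<longrightarrow>
           (SPDI2 {1..n} X \<I> \<longleftrightarrow>
             (\<exists>a\<in>{0, 1 :: nat}. \<forall>i\<in>{1..2}.
               strictly_CND (PiE (F i) X) (\<lambda>u v. (-1) ^ a * K i u v))))
       \<and> (l = 2 \<and> 2 < n \<and> card (F 2) = 1 \<longrightarrow>
           (SPDI2 {1..n} X \<I> \<longleftrightarrow>
             (\<exists>a\<in>{0, 1 :: nat}.
               strictly_CND (PiE (F 1) X) (\<lambda>u v. (-1) ^ (a + 1) * K 1 u v) \<and>
               SPD (PiE (F 2) X) (\<lambda>u v. (-1) ^ a * K 2 u v))))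
       \<and> (l = 2 \<and> 2 < n \<and> card (F 2) \<ge> 2 \<longrightarrow>
           (SPDI2 {1..n} X \<I> \<longleftrightarrow>
             (\<exists>a\<in>{0, 1 :: nat}. \<forall>i\<in>{1..2}.
               SPD (PiE (F i) X) (\<lambda>u v. (-1) ^ a * K i u v))))"
proof -
  have I: "(\<Union>i\<in>{1..l}. F i) = {1..n}" by fact
  \<comment> \<open>Serves cases (i) and (iv), which share the property that at least two indices
    lie outside every block.\<close>
  have many: "SPDI2 {1..n} X \<I> \<longleftrightarrow>
      (\<exists>a :: nat \<Rightarrow> nat. (\<forall>i\<in>{1..l}. a i \<in> {0, 1} \<and> SPD (PiE (F i) X) (\<lambda>u v. (-1) ^ a i * K i u v))
        \<and> even (\<Sum>i=1..l. a i))"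
    if "\<And>i. i \<in> {1..l} \<Longrightarrow> card ({1..n} - F i) \<ge> 2"
    unfolding \<I>_def
    by (rule SPDI2_iff_SPD_factors[OF I[symmetric] _ _ _ assms(6,4,5,10) that]) (use assms(3) in auto)
  show ?thesis
  proof (cases "l > 2")
    case True
    have "card ({1..n} - F i) \<ge> 2" if "i \<in> {1..l}" for i
      using card_outside_block[OF assms(6) _ assms(8) _ that] True that unfolding I by simp
    with many True show ?thesis by simp
  next
    case False
    then have l: "l = 2" using assms(3) by linarith
    have J: "{1..2::nat} = {1, 2}" by auto
    note F = assms(6,8)[unfolded l J]
    have U: "{1..n} = F 1 \<union> F 2" using I unfolding l J by simp
    have disj: "F 1 \<inter> F 2 = {}" using F(1) by (simp add: disjoint_family_on_def)
    have fin: "finite (F 1)" "finite (F 2)" using finite_atLeastAtMost[of 1 n] unfolding U by simp_all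
    have card_Un: "card (F 1) + card (F 2) = n"
      using card_Un_disjoint[OF fin disj] unfolding U[symmetric] by simp
    have pos: "card (F 1) \<ge> 1" "card (F 2) \<ge> 1"
      using fin F(2) by (simp_all add: Suc_le_eq card_gt_0_iff)
    \<comment> \<open>By the ordering of the blocks, a lower bound on the size of \<open>F 2\<close>
      also holds for \<open>F 1\<close>.\<close>
    have mono: "card (F 2) \<le> card (F 1)" using assms(9) by (auto simp: l monotone_on_def)
    have diff: "{1..n} - F 1 = F 2" "{1..n} - F 2 = F 1" unfolding U using disj by auto
    have prod: "\<I> = (\<lambda>x y. K 1 (restrict x (F 1)) (restrict y (F 1)) * K 2 (restrict x (F 2)) (restrict y (F 2)))"
      unfolding \<I>_def l J by simp
    have cs: "coordinate_symmetric {1..n} X \<I>"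
      unfolding \<I>_def I[symmetric] using assms(10) by (rule coordinate_symmetric_prod)
    have sym: "symmetric_kernel (PiE (F 1) X) (K 1)" "symmetric_kernel (PiE (F 2) X) (K 2)"
      using assms(10)[unfolded l J] by (simp_all add: coordinate_symmetric_imp_symmetric_kernel)
    note block = cs[unfolded prod U] sym disj
    \<comment> \<open>Two nonempty blocks with two indices in total have one index each.\<close>
    have ii: "SPDI2 {1..n} X \<I> \<longleftrightarrow> (\<exists>a\<in>{0, 1 :: nat}. \<forall>i\<in>{1..2}.
        strictly_CND (PiE (F i) X) (\<lambda>u v. (-1) ^ a * K i u v))" if "n = 2"
      unfolding strictly_CND_common_sign_iff J prod U
      using SPDI2_singleton_blocks_iff[OF block _ _ assms(4,5)[unfolded U]] card_Un pos that by simp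
    have iii: "SPDI2 {1..n} X \<I> \<longleftrightarrow> (\<exists>a\<in>{0, 1 :: nat}.
        strictly_CND (PiE (F 1) X) (\<lambda>u v. (-1) ^ (a + 1) * K 1 u v) \<and>
        SPD (PiE (F 2) X) (\<lambda>u v. (-1) ^ a * K 2 u v))" if "2 < n" "card (F 2) = 1"
      unfolding strictly_CND_sign prod U
      by (rule SPDI2_one_singleton_block_iff[OF block _ that(2) assms(4,5)[unfolded U]])
        (use card_Un that in simp_all)
    \<comment> \<open>Each block is the complement of the other and both have at least two indices;
      the even sum of exponents becomes one common exponent.\<close>
    have iv: "SPDI2 {1..n} X \<I> \<longleftrightarrow> (\<exists>a\<in>{0, 1 :: nat}. \<forall>i\<in>{1..2}.
        SPD (PiE (F i) X) (\<lambda>u v. (-1) ^ a * K i u v))" if c2: "card (F 2) \<ge> 2"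
    proof -
      have "card ({1..n} - F i) \<ge> 2" if i: "i \<in> {1..l}" for i
      proof -
        consider "i = 1" | "i = 2" using i unfolding l J by blast
        then show ?thesis using c2 mono by cases (simp_all only: diff)
      qed
      then have "SPDI2 {1..n} X \<I> \<longleftrightarrow> (\<exists>a :: nat \<Rightarrow> nat.
          (\<forall>i\<in>{1..l}. a i \<in> {0, 1} \<and> SPD (PiE (F i) X) (\<lambda>u v. (-1) ^ a i * K i u v))
          \<and> even (\<Sum>i=1..l. a i))"
        by (rule many)
      also have "\<dots> \<longleftrightarrow> (\<exists>a\<in>{0, 1 :: nat}. \<forall>i\<in>{1..2}.
          SPD (PiE (F i) X) (\<lambda>u v. (-1) ^ a * K i u v))"
        unfolding l by (rule ex_even_pair_iff)
      finally show ?thesis .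
    qed
    show ?thesis
      by (intro conjI impI; (elim conjE)?) (use l ii iii iv in simp_all)
  qed
qed

end
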